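(* Let $K$ be a self-similar compact metric space with $\dim_t K>0$. Then for the generic $f\in C(K)$, for the generic $y\in f(K)$, $$\dim_H f^{-1}(y)=\dim_{tH}K-1.$$
   Context: $K$ is self-similar if there are finitely many injective contractive similitudes $\varphi_1,\dots,\varphi_k\colon K\to K$ (i.e. each $\varphi_i$ multiplies all distances by a constant ratio $r_i\in(0,1)$) such that $K=\bigcup_{i=1}^k\varphi_i(K)$. $C(K)$ is the space of continuous functions $f\colon K\to\mathbb{R}$ with the supremum metric. For a complete metric space $Z$ (here $Z=C(K)$, or $Z=f(K)\subseteq\mathbb{R}$), "the generic $z\in Z$ has property $\mathcal P$" means that $\{z\in Z: z\text{ has }\mathcal P\}$ is co-meager in $Z$ (its complement is a countable union of nowhere dense subsets of $Z$). $\dim_H$ denotes Hausdorff dimension, with the convention $\dim_H\emptyset=-1$. $\dim_t$ denotes the (small inductive) topological dimension: $\dim_t\emptyset=-1$ and, for non-empty $X$, inductively $\dim_t X=\inf\{d: X \text{ has a basis } \mathcal U \text{ with } \dim_t\partial U\le d-1 \text{ for every } U\in\mathcal U\}$. The topological Hausdorff dimension is defined by $\dim_{tH}\emptyset=-1$ and, for a non-empty metric space $X$, $\dim_{tH}X=\inf\{d: X \text{ has a basis } \mathcal U \text{ of open sets such that } \dim_H\partial U\le d-1 \text{ for every } U\in\mathcal U\}$. All these can take the value $\infty$ ($d=\infty$ is allowed), with the convention $\infty-1=\infty$. *)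

theory Defs
  imports "HOL-Analysis.Analysis"
begin

section \<open>Self-similar sets\<close>

definition contractive_similitude :: "'a::metric_space set \<Rightarrow> ('a \<Rightarrow> 'a) \<Rightarrow> bool" where
  "contractive_similitude K \<phi> \<longleftrightarrow>
     \<phi> ` K \<subseteq> K \<and> inj_on \<phi> K \<and>
     (\<exists>r. 0 < r \<and> r < 1 \<and> (\<forall>x\<in>K. \<forall>y\<in>K. dist (\<phi> x) (\<phi> y) = r * dist x y))"

definition self_similar :: "'a::metric_space set \<Rightarrow> bool" where
  "self_similar K \<longleftrightarrow>
     (\<exists>(k::nat) \<phi>. (\<forall>i<k. contractive_similitude K (\<phi> i)) \<and> K = (\<Union>i<k. \<phi> i ` K))"


section \<open>Genericity\<close>

definition nowhere_dense_in :: "'a topology \<Rightarrow> 'a set \<Rightarrow> bool" where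
  "nowhere_dense_in X N \<longleftrightarrow> N \<subseteq> topspace X \<and> X interior_of (X closure_of N) = {}"

definition generic_in :: "'a topology \<Rightarrow> ('a \<Rightarrow> bool) \<Rightarrow> bool" where
  "generic_in X P \<longleftrightarrow>
     (\<exists>\<N>. countable \<N> \<and> (\<forall>N\<in>\<N>. nowhere_dense_in X N) \<and>
          {z \<in> topspace X. \<not> P z} = \<Union>\<N>)"

text \<open>
  The elements of \<^const>\<open>cfunspace\<close> are functions on the whole type that are \<^const>\<open>undefined\<close>
  outside \<open>K\<close>, so they correspond one-to-one to the continuous functions on \<open>K\<close>; for compact \<open>K\<close>
  the boundedness condition built into \<^const>\<open>cfunspace\<close> is automatic.
\<close>
definition C_space :: "'a::metric_space set \<Rightarrow> ('a \<Rightarrow> real) metric" where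
  "C_space K = cfunspace (top_of_set K) euclidean_metric"


section \<open>Dimensions\<close>

definition base_of :: "'a topology \<Rightarrow> 'a set set \<Rightarrow> bool" where
  "base_of X \<B> \<longleftrightarrow> openin X = arbitrary union_of (\<lambda>U. U \<in> \<B>)"

subsection \<open>Hausdorff dimension\<close>

text \<open>
  The summand \<open>(diam U)\<^sup>s\<close>, where the empty set always contributes \<open>0\<close> and \<open>(diam U)\<^sup>0 = 1\<close> for
  every non-empty \<open>U\<close>. The case distinction is needed because of \<open>0 powr 0 = 0\<close>.
\<close>
definition diam_pow :: "real \<Rightarrow> 'a::metric_space set \<Rightarrow> ennreal" where
  "diam_pow s U =
     (if U = {} then 0 else if s = 0 then 1 else ennreal (diameter U powr s))"

text \<open>Boundedness is required since \<^const>\<open>diameter\<close> is meaningless on unbounded sets.\<close>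
definition hausdorff_premeasure :: "real \<Rightarrow> real \<Rightarrow> 'a::metric_space set \<Rightarrow> ennreal" where
  "hausdorff_premeasure s \<delta> A =
     (INF U \<in> {U :: nat \<Rightarrow> 'a set. A \<subseteq> (\<Union>i. U i) \<and> (\<forall>i. bounded (U i) \<and> diameter (U i) \<le> \<delta>)}.
        \<Sum>i. diam_pow s (U i))"

definition hausdorff_measure :: "real \<Rightarrow> 'a::metric_space set \<Rightarrow> ennreal" where
  "hausdorff_measure s A = (SUP \<delta> \<in> {0<..}. hausdorff_premeasure s \<delta> A)"

definition dim_H :: "'a::metric_space set \<Rightarrow> ereal" where
  "dim_H A = (if A = {} then -1 else Inf {ereal s | s. 0 \<le> s \<and> hausdorff_measure s A = 0})"

subsection \<open>Topological Hausdorff dimension\<close>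

definition dim_tH :: "'a::metric_space set \<Rightarrow> ereal" where
  "dim_tH X =
     (if X = {} then -1
      else Inf {d. \<exists>\<U>. base_of (top_of_set X) \<U> \<and>
                       (\<forall>U\<in>\<U>. dim_H (top_of_set X frontier_of U) \<le> d - 1)})"

subsection \<open>Small inductive dimension\<close>

text \<open>
  The library has the inductive relation \<^const>\<open>dimension_le\<close>, but no dimension function. The
  lemmas \<open>dim_t_empty\<close> and \<open>dim_t_nonempty\<close> below are the usual recursive description.
\<close>
definition dim_t :: "'a topology \<Rightarrow> ereal" where
  "dim_t X = Inf {ereal (of_int n) | n. X dim_le n}"

lemma dim_t_le_iff: "dim_t X \<le> ereal r \<longleftrightarrow> X dim_le \<lfloor>r\<rfloor>"
proof
  assume "X dim_le \<lfloor>r\<rfloor>"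
  then have "dim_t X \<le> ereal (of_int \<lfloor>r\<rfloor>)"
    unfolding dim_t_def by (intro Inf_lower) auto
  also have "\<dots> \<le> ereal r"
    by simp
  finally show "dim_t X \<le> ereal r" .
next
  assume *: "dim_t X \<le> ereal r"
  have "dim_t X < ereal (of_int (\<lfloor>r\<rfloor> + 1))"
    by (rule le_less_trans[OF *]) (simp only: ereal_less_eq less_ereal.simps, linarith)
  then obtain n where n: "X dim_le n" "ereal (of_int n) < ereal (of_int (\<lfloor>r\<rfloor> + 1))"
    unfolding dim_t_def Inf_less_iff by auto
  then have "n \<le> \<lfloor>r\<rfloor>"
    by simp
  with n(1) show "X dim_le \<lfloor>r\<rfloor>"
    using dimension_le_mono by blast
qed

lemma dim_t_ge_minus_one: "-1 \<le> dim_t X"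
  unfolding dim_t_def
proof (intro Inf_greatest, clarify)
  fix n assume "X dim_le n"
  then have "-1 \<le> n"
    by (rule dimension_le_bound)
  then have "ereal (of_int (-1)) \<le> ereal (of_int n)"
    unfolding ereal_less_eq of_int_le_iff .
  then show "-1 \<le> ereal (of_int n)"
    by (simp add: one_ereal_def)
qed

lemma dim_t_empty:
  assumes "topspace X = {}"
  shows "dim_t X = -1"
proof (rule antisym)
  have "\<lfloor>-1 :: real\<rfloor> = -1"
    by linarith
  moreover have "X dim_le -1"
    using assms by (simp add: null_topspace_iff_trivial)
  ultimately have "dim_t X \<le> ereal (-1)"
    unfolding dim_t_le_iff by simp
  then show "dim_t X \<le> -1"
    by (simp add: one_ereal_def)
qed (rule dim_t_ge_minus_one)

lemma dim_t_nonempty: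
  assumes "topspace X \<noteq> {}"
  shows "dim_t X =
    Inf {d. \<exists>\<U>. base_of X \<U> \<and>
                (\<forall>U\<in>\<U>. dim_t (subtopology X (X frontier_of U)) \<le> d - 1)}"
    (is "_ = Inf ?D")
proof (rule antisym)
  show "dim_t X \<le> Inf ?D"
  proof (rule Inf_greatest)
    fix d assume "d \<in> ?D"
    then obtain \<U> where base: "base_of X \<U>"
      and dim: "\<And>U. U \<in> \<U> \<Longrightarrow> dim_t (subtopology X (X frontier_of U)) \<le> d - 1"
      by blast
    have op: "openin X U" if "U \<in> \<U>" for U
      using base that unfolding base_of_def openin_topology_base_unique by blast
    have nb: "\<exists>U\<in>\<U>. a \<in> U \<and> U \<subseteq> V" if "openin X V" "a \<in> V" for V a
      using base that unfolding base_of_def openin_topology_base_unique by blast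
    obtain U0 where U0: "U0 \<in> \<U>"
      using assms nb[OF openin_topspace] by blast
    have d: "-1 \<le> d - 1"
      using dim_t_ge_minus_one dim[OF U0] by (rule order_trans)
    show "dim_t X \<le> d"
    proof (cases d)
      case (real r)
      then have "0 \<le> r"
        using d by (simp add: one_ereal_def)
      have "X dim_le \<lfloor>r\<rfloor>"
      proof (rule dimension_le.intros)
        show "-1 \<le> \<lfloor>r\<rfloor>"
          using \<open>0 \<le> r\<close> by linarith
      next
        fix V a assume "openin X V" "a \<in> V"
        then obtain U where U: "U \<in> \<U>" "a \<in> U" "U \<subseteq> V"
          using nb by blast
        have "dim_t (subtopology X (X frontier_of U)) \<le> ereal (r - 1)"
          using dim[OF U(1)] real by (simp add: one_ereal_def)
        then have "subtopology X (X frontier_of U) dim_le (\<lfloor>r\<rfloor> - 1)"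
          unfolding dim_t_le_iff by simp
        with U op show "\<exists>U. a \<in> U \<and> U \<subseteq> V \<and> openin X U \<and>
            subtopology X (X frontier_of U) dim_le (\<lfloor>r\<rfloor> - 1)"
          by blast
      qed
      then show ?thesis
        using real by (simp add: dim_t_le_iff)
    qed (use d in \<open>auto simp: one_ereal_def\<close>)
  qed
  show "Inf ?D \<le> dim_t X"
    unfolding dim_t_def[of X]
  proof (intro Inf_greatest, clarify)
    fix n assume n: "X dim_le n"
    let ?\<U> = "{U. openin X U \<and> subtopology X (X frontier_of U) dim_le (n - 1)}"
    have "base_of X ?\<U>"
      unfolding base_of_def openin_topology_base_unique
      using n by (subst (asm) dimension_le.simps) blast
    moreover have "dim_t (subtopology X (X frontier_of U)) \<le> ereal (of_int n) - 1"
      if "U \<in> ?\<U>" for U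
      using that dim_t_le_iff[of "subtopology X (X frontier_of U)" "of_int (n - 1)"]
      by (simp add: one_ereal_def)
    ultimately show "Inf ?D \<le> ereal (of_int n)"
      by (intro Inf_lower) blast
  qed
qed

end

theory Submission
  imports Defs
begin

text \<open>
  Lower bound: if the functions having a dense set of values with level sets of dimension at most
  \<open>s\<close> were dense in some ball of \<open>C(K)\<close>, then perturbing by bumps would yield a basis of \<open>K\<close> whose
  boundaries lie in such level sets, whence \<open>dim_tH K \<le> s + 1\<close>. So for \<open>s < dim_tH K - 1\<close> a generic
  function has an interval of values with level sets of dimension above \<open>s\<close>, and by self-similarity
  this happens inside each small copy of \<open>K\<close>; hence such values contain a dense open subset of
  \<open>f(K)\<close>.

  Upper bound: given \<open>s > dim_tH K - 1\<close>, a continuous \<open>f\<close> and \<open>x \<in> K\<close>, there is a small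
  perturbation of \<open>f\<close> whose level set through \<open>x\<close> consists of \<open>x\<close> and the boundary of a finite union of
  basic sets, hence is \<open>s\<close>-null (here \<open>s > 0\<close>, because \<open>dim_t K > 0\<close>). Having a small open cover
  of a level set is stable under small changes of the function and of the value, so a Baire
  category argument applies.
\<close>

section \<open>Auxiliary bounds for diameters and series\<close>

lemma diameter_leI:
  assumes "0 \<le> d" "\<And>x y. x \<in> S \<Longrightarrow> y \<in> S \<Longrightarrow> dist x y \<le> d"
  shows "diameter S \<le> d"
  using assms by (auto simp: diameter_def intro: cSUP_least)

lemma bounded_if_dist_le:
  assumes "\<And>x y. x \<in> S \<Longrightarrow> y \<in> S \<Longrightarrow> dist x y \<le> d"
  shows "bounded S"
proof (cases "S = {}")
  case False
  then obtain x where "x \<in> S"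
    by blast
  then show ?thesis
    using assms[of x] unfolding bounded_def by blast
qed simp

text \<open>Serves to merge two countable covers into one sequence. The first \<open>2*n\<close>
  terms split exactly into \<open>n\<close> terms of each series.\<close>

lemma suminf_interleave_le:
  fixes f g :: "nat \<Rightarrow> ennreal"
  shows "(\<Sum>i. if even i then f (i div 2) else g (i div 2)) \<le> (\<Sum>i. f i) + (\<Sum>i. g i)"
    (is "suminf ?h \<le> _")
proof (rule suminf_le_const[OF summableI])
  fix n
  have split: "sum ?h {..<2*n} = sum f {..<n} + sum g {..<n}"
    by (induction n) (auto simp: algebra_simps)
  have "sum ?h {..<n} \<le> sum ?h {..<2*n}"
    by (rule sum_mono2) auto
  also have "\<dots> \<le> (\<Sum>i. f i) + (\<Sum>i. g i)"
    unfolding split by (intro add_mono sum_le_suminf summableI) auto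
  finally show "sum ?h {..<n} \<le> (\<Sum>i. f i) + (\<Sum>i. g i)" .
qed

section \<open>Hausdorff null sets\<close>

lemma hausdorff_premeasure_mono:
  "A \<subseteq> B \<Longrightarrow> hausdorff_premeasure s \<delta> A \<le> hausdorff_premeasure s \<delta> B"
  unfolding hausdorff_premeasure_def by (rule INF_superset_mono) auto

lemma hausdorff_premeasure_antimono:
  "\<delta> \<le> \<delta>' \<Longrightarrow> hausdorff_premeasure s \<delta>' A \<le> hausdorff_premeasure s \<delta> A"
  unfolding hausdorff_premeasure_def by (rule INF_superset_mono) (auto intro: order_trans)

lemma hausdorff_premeasure_le:
  assumes "A \<subseteq> (\<Union>i. U i)" "\<And>i. bounded (U i)" "\<And>i. diameter (U i) \<le> \<delta>"
  shows "hausdorff_premeasure s \<delta> A \<le> (\<Sum>i. diam_pow s (U i))"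
  unfolding hausdorff_premeasure_def by (rule INF_lower) (use assms in auto)

lemma hausdorff_premeasure_lessE:
  assumes "hausdorff_premeasure s \<delta> A < e"
  obtains U where "A \<subseteq> (\<Union>i. U i)" "\<And>i::nat. bounded (U i)" "\<And>i. diameter (U i) \<le> \<delta>"
    "(\<Sum>i. diam_pow s (U i)) < e"
  using assms unfolding hausdorff_premeasure_def INF_less_iff by auto

lemma hausdorff_measure_eq_0_iff:
  "hausdorff_measure s A = 0 \<longleftrightarrow> (\<forall>\<delta>>0. hausdorff_premeasure s \<delta> A = 0)"
proof -
  have "hausdorff_measure s A \<le> 0 \<longleftrightarrow> (\<forall>\<delta>>0. hausdorff_premeasure s \<delta> A \<le> 0)"
    unfolding hausdorff_measure_def by (auto simp: SUP_le_iff simp del: le_zero_eq)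
  then show ?thesis
    by simp
qed

lemma hausdorff_null_subset:
  assumes "hausdorff_measure s B = 0" "A \<subseteq> B"
  shows "hausdorff_measure s A = 0"
  unfolding hausdorff_measure_eq_0_iff
proof (intro allI impI)
  fix \<delta> :: real assume "\<delta> > 0"
  then have "hausdorff_premeasure s \<delta> B = 0"
    using assms(1) unfolding hausdorff_measure_eq_0_iff by simp
  then show "hausdorff_premeasure s \<delta> A = 0"
    using hausdorff_premeasure_mono[OF assms(2), of s \<delta>] by simp
qed

lemma hausdorff_null_Un:
  assumes "hausdorff_measure s A = 0" "hausdorff_measure s B = 0"
  shows "hausdorff_measure s (A \<union> B) = 0"
  unfolding hausdorff_measure_eq_0_iff
proof (intro allI impI)
  fix \<delta> :: real assume "\<delta> > 0"
  \<comment> \<open>The summand \<open>0\<close> gives the bound the shape that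
    \<open>ennreal_le_epsilon\<close> expects.\<close>
  have "hausdorff_premeasure s \<delta> (A \<union> B) \<le> 0 + ennreal e" if "e > 0" for e
  proof -
    have *: "hausdorff_premeasure s \<delta> A < ennreal (e/2)" "hausdorff_premeasure s \<delta> B < ennreal (e/2)"
      using assms \<open>\<delta> > 0\<close> \<open>e > 0\<close> unfolding hausdorff_measure_eq_0_iff by auto
    obtain U where U: "A \<subseteq> (\<Union>i. U i)" "\<And>i::nat. bounded (U i)" "\<And>i. diameter (U i) \<le> \<delta>"
      "(\<Sum>i. diam_pow s (U i)) < ennreal (e/2)"
      by (rule hausdorff_premeasure_lessE[OF *(1)]) (rule that)
    obtain V where V: "B \<subseteq> (\<Union>i. V i)" "\<And>i::nat. bounded (V i)" "\<And>i. diameter (V i) \<le> \<delta>"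
      "(\<Sum>i. diam_pow s (V i)) < ennreal (e/2)"
      by (rule hausdorff_premeasure_lessE[OF *(2)]) (rule that)
    define W where "W i = (if even i then U (i div 2) else V (i div 2))" for i :: nat
    have "A \<union> B \<subseteq> (\<Union>i. W i)"
    proof
      fix x assume "x \<in> A \<union> B"
      then obtain i where "x \<in> U i \<or> x \<in> V i"
        using U(1) V(1) by auto
      then have "x \<in> W (2*i) \<or> x \<in> W (2*i+1)"
        by (simp add: W_def)
      then show "x \<in> (\<Union>i. W i)"
        by blast
    qed
    then have "hausdorff_premeasure s \<delta> (A \<union> B) \<le> (\<Sum>i. diam_pow s (W i))"
      by (rule hausdorff_premeasure_le) (simp_all add: W_def U V)
    also have "\<dots> = (\<Sum>i. if even i then diam_pow s (U (i div 2)) else diam_pow s (V (i div 2)))"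
      by (rule suminf_cong) (simp add: W_def)
    also have "\<dots> \<le> (\<Sum>i. diam_pow s (U i)) + (\<Sum>i. diam_pow s (V i))"
      by (rule suminf_interleave_le)
    also have "\<dots> \<le> ennreal (e/2) + ennreal (e/2)"
      using U(4) V(4) by (intro add_mono) auto
    also have "\<dots> = ennreal e"
      using \<open>e > 0\<close> by (subst ennreal_plus[symmetric]) auto
    finally show ?thesis by simp
  qed
  then have "hausdorff_premeasure s \<delta> (A \<union> B) \<le> 0"
    by (rule ennreal_le_epsilon)
  then show "hausdorff_premeasure s \<delta> (A \<union> B) = 0"
    by simp
qed

text \<open>The constant cover by \<open>{x}\<close> costs \<open>0 powr s\<close>, which is
  \<open>0\<close>. For \<open>s = 0\<close> each copy would cost \<open>1\<close>.\<close>

lemma hausdorff_null_singleton: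
  assumes "s > 0"
  shows "hausdorff_measure s {x} = 0"
  unfolding hausdorff_measure_eq_0_iff
proof (intro allI impI)
  fix \<delta> :: real assume "\<delta> > 0"
  then have "hausdorff_premeasure s \<delta> {x} \<le> (\<Sum>i::nat. diam_pow s {x})"
    by (intro hausdorff_premeasure_le) auto
  also have "\<dots> = 0"
    using assms by (simp add: diam_pow_def)
  finally show "hausdorff_premeasure s \<delta> {x} = 0"
    by simp
qed

lemma hausdorff_null_empty: "s > 0 \<Longrightarrow> hausdorff_measure s {} = 0"
  by (rule hausdorff_null_subset[OF hausdorff_null_singleton]) auto

lemma hausdorff_null_UN:
  assumes "s > 0" "finite I" "\<And>i. i \<in> I \<Longrightarrow> hausdorff_measure s (A i) = 0"
  shows "hausdorff_measure s (\<Union>i\<in>I. A i) = 0"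
  using assms(2,3)
  by (induction I rule: finite_induct) (auto simp: hausdorff_null_empty[OF \<open>s > 0\<close>] intro: hausdorff_null_Un)

lemma diam_pow_antimono:
  assumes "0 \<le> t" "t \<le> s" "bounded U" "diameter U \<le> 1"
  shows "diam_pow s U \<le> diam_pow t U"
proof -
  \<comment> \<open>The second inequality is for \<open>t = 0\<close>, where
    \<open>diam_pow t U\<close> is \<open>1\<close> and not
    \<open>diameter U powr 0\<close>.\<close>
  have "diameter U powr s \<le> diameter U powr t" "diameter U powr s \<le> 1"
    using assms diameter_ge_0[OF \<open>bounded U\<close>] by (auto intro: powr_mono' powr_le1)
  then show ?thesis
    using assms by (auto simp: diam_pow_def ennreal_leI)
qed

lemma hausdorff_null_mono:
  assumes "hausdorff_measure t A = 0" "0 \<le> t" "t \<le> s"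
  shows "hausdorff_measure s A = 0"
  unfolding hausdorff_measure_eq_0_iff
proof (intro allI impI)
  fix \<delta> :: real assume "\<delta> > 0"
  \<comment> \<open>Capping the mesh at \<open>1\<close> makes the powers decrease in the
    exponent.\<close>
  let ?d = "min \<delta> 1"
  have "hausdorff_premeasure s \<delta> A \<le> hausdorff_premeasure s ?d A"
    by (rule hausdorff_premeasure_antimono) simp
  also have "\<dots> \<le> hausdorff_premeasure t ?d A"
    unfolding hausdorff_premeasure_def
    by (rule INF_mono) (use assms in \<open>auto intro!: suminf_le summableI diam_pow_antimono\<close>)
  also have "\<dots> = 0"
    using assms(1) \<open>\<delta> > 0\<close> unfolding hausdorff_measure_eq_0_iff by simp
  finally show "hausdorff_premeasure s \<delta> A = 0"
    by simp
qed

lemma hausdorff_null_if_dim_H_less: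
  assumes "dim_H A < ereal s" "s > 0"
  shows "hausdorff_measure s A = 0"
proof (cases "A = {}")
  case False
  then obtain t where "0 \<le> t" "hausdorff_measure t A = 0" "t < s"
    using assms by (auto simp: dim_H_def Inf_less_iff)
  then show ?thesis
    by (auto intro: hausdorff_null_mono)
qed (simp add: hausdorff_null_empty assms)

text \<open>An \<open>r\<close>-neighbourhood has diameter at most \<open>D + 2 * r\<close>, and for
  \<open>s > 0\<close> the power is continuous there from the right, even at
  \<open>D = 0\<close>.\<close>

lemma diam_pow_thicken:
  fixes U :: "'a::metric_space set"
  assumes "s > 0" "bounded U" "e > 0"
  shows "\<exists>r>0. r \<le> e \<and> diam_pow s (\<Union>x\<in>U. ball x r) \<le> diam_pow s U + ennreal e
    \<and> bounded (\<Union>x\<in>U. ball x r) \<and> diameter (\<Union>x\<in>U. ball x r) \<le> diameter U + e"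
proof -
  define D where "D = diameter U"
  have D0: "0 \<le> D"
    using diameter_ge_0 assms by (simp add: D_def)
  have "((\<lambda>t. (D + 2 * t) powr s) \<longlongrightarrow> (D + 2 * 0) powr s) (at_right 0)"
  proof (rule tendsto_powr2)
    show "\<forall>\<^sub>F t in at_right 0. 0 \<le> D + 2 * t"
      using D0 by (auto simp: eventually_at intro!: exI[of _ 1])
  qed (use assms in \<open>auto intro!: tendsto_eq_intros\<close>)
  then have "\<forall>\<^sub>F t in at_right 0. (D + 2 * t) powr s < D powr s + e"
    using assms by (intro order_tendstoD(2)) auto
  moreover have "\<forall>\<^sub>F t in at_right (0::real). t < e / 2"
    using assms by (intro eventually_at_right_real order_tendstoD(2)[OF tendsto_ident_at]) auto
  moreover have "\<forall>\<^sub>F t in at_right (0::real). 0 < t"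
    by (simp add: eventually_at_right_less)
  ultimately have "\<forall>\<^sub>F t in at_right 0. (D + 2 * t) powr s < D powr s + e \<and> t < e / 2 \<and> 0 < t"
    by eventually_elim auto
  then obtain r where r: "(D + 2 * r) powr s < D powr s + e" "r < e / 2" "0 < r"
    using eventually_happens'[OF trivial_limit_at_right_real] by blast
  let ?V = "\<Union>x\<in>U. ball x r"
  have dist_V: "dist a b \<le> D + 2 * r" if ab: "a \<in> ?V" "b \<in> ?V" for a b
  proof -
    obtain x y where xy: "x \<in> U" "y \<in> U" "dist x a < r" "dist y b < r"
      using ab by auto
    have "dist x y \<le> D"
      unfolding D_def using xy assms by (intro diameter_bounded_bound)
    moreover have "dist a b \<le> dist x a + dist x y + dist y b"
      by (smt (verit) dist_commute dist_triangle)
    ultimately show ?thesis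
      using xy by linarith
  qed
  have bV: "bounded ?V"
    by (rule bounded_if_dist_le[OF dist_V])
  have dV: "diameter ?V \<le> D + 2 * r"
    by (rule diameter_leI[OF _ dist_V]) (use D0 r in auto)
  have "diam_pow s ?V \<le> diam_pow s U + ennreal e"
  proof (cases "U = {}")
    case False
    then have "?V \<noteq> {}"
      using r by auto
    then have "diam_pow s ?V = ennreal (diameter ?V powr s)"
      using assms by (simp add: diam_pow_def)
    also have "\<dots> \<le> ennreal ((D + 2 * r) powr s)"
      using dV assms diameter_ge_0[OF bV] by (intro ennreal_leI powr_mono2) auto
    also have "\<dots> \<le> ennreal (D powr s + e)"
      using r by (intro ennreal_leI) auto
    also have "\<dots> = diam_pow s U + ennreal e"
      using False assms by (simp add: diam_pow_def D_def)
    finally show ?thesis .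
  qed (simp add: diam_pow_def)
  then show ?thesis
    using r bV dV by (intro exI[of _ r]) (auto simp: D_def)
qed

text \<open>Take a cheap cover and thicken its members to open sets, with errors \<open>c i\<close>
  forming a geometric series of sum \<open>\<eta>\<close>.\<close>

lemma hausdorff_null_open_superset:
  fixes A :: "'a::metric_space set"
  assumes "hausdorff_measure s A = 0" "s > 0" "\<delta> > 0" "e > 0"
  shows "\<exists>W. open W \<and> A \<subseteq> W \<and> hausdorff_premeasure s \<delta> W < ennreal e"
proof -
  \<comment> \<open>Mesh: \<open>\<delta>/2\<close> plus at most
    \<open>\<eta> \<le> \<delta>/2\<close>. Cost: below \<open>e/2\<close>, plus
    \<open>\<eta> \<le> e/4\<close>.\<close>
  define \<eta> where "\<eta> = min (\<delta>/2) (e/4)"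
  have \<eta>: "\<eta> > 0" "\<eta> \<le> \<delta>/2" "\<eta> \<le> e/4"
    using assms by (auto simp: \<eta>_def)
  have "hausdorff_premeasure s (\<delta>/2) A = 0"
    using assms unfolding hausdorff_measure_eq_0_iff by simp
  then have "hausdorff_premeasure s (\<delta>/2) A < ennreal (e/2)"
    using assms by simp
  from hausdorff_premeasure_lessE[OF this] obtain U where
    U: "A \<subseteq> (\<Union>i. U i)" "\<And>i::nat. bounded (U i)" "\<And>i. diameter (U i) \<le> \<delta>/2"
      "(\<Sum>i. diam_pow s (U i)) < ennreal (e/2)"
    by blast
  define c where "c i = \<eta> * (1/2)^Suc i" for i
  have c: "c i > 0" "c i \<le> \<eta>" for i
  proof -
    show "c i > 0"
      using \<eta> by (simp add: c_def)
    have "(1/2::real)^Suc i \<le> 1"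
      by (intro power_le_one) auto
    then show "c i \<le> \<eta>"
      using \<eta> by (simp only: c_def mult_left_le)
  qed
  have "\<exists>r>0. r \<le> c i \<and> diam_pow s (\<Union>x\<in>U i. ball x r) \<le> diam_pow s (U i) + ennreal (c i)
    \<and> bounded (\<Union>x\<in>U i. ball x r) \<and> diameter (\<Union>x\<in>U i. ball x r) \<le> diameter (U i) + c i" for i
    by (rule diam_pow_thicken) (use assms U c in auto)
  then obtain r where r: "\<And>i. r i > 0"
      "\<And>i. diam_pow s (\<Union>x\<in>U i. ball x (r i)) \<le> diam_pow s (U i) + ennreal (c i)"
      "\<And>i. bounded (\<Union>x\<in>U i. ball x (r i))"
      "\<And>i. diameter (\<Union>x\<in>U i. ball x (r i)) \<le> diameter (U i) + c i"
    by metis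
  define V where "V i = (\<Union>x\<in>U i. ball x (r i))" for i
  have c_sums: "c sums \<eta>"
    unfolding c_def using sums_mult[OF power_half_series, of \<eta>] by simp
  have "hausdorff_premeasure s \<delta> (\<Union>i. V i) \<le> (\<Sum>i. diam_pow s (V i))"
  proof (rule hausdorff_premeasure_le)
    fix i
    show "diameter (V i) \<le> \<delta>"
      using r(4)[of i] U(3)[of i] c(2)[of i] \<eta> by (simp add: V_def)
  qed (use r in \<open>auto simp: V_def\<close>)
  also have "\<dots> \<le> (\<Sum>i. diam_pow s (U i) + ennreal (c i))"
    by (intro suminf_le summableI) (use r in \<open>auto simp: V_def\<close>)
  also have "\<dots> = (\<Sum>i. diam_pow s (U i)) + (\<Sum>i. ennreal (c i))"
    by (intro suminf_add[symmetric] summableI)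
  also have "(\<Sum>i. ennreal (c i)) = ennreal \<eta>"
    using c_sums c(1) by (subst suminf_ennreal2) (auto simp: sums_iff less_imp_le)
  also have "(\<Sum>i. diam_pow s (U i)) + ennreal \<eta> \<le> ennreal (e/2) + ennreal (e/4)"
    using U(4) \<eta> by (intro add_mono ennreal_leI) auto
  also have "\<dots> = ennreal (e/2 + e/4)"
    using assms by (intro ennreal_plus[symmetric]) auto
  also have "\<dots> < ennreal e"
    using assms by (intro ennreal_lessI) auto
  finally have "hausdorff_premeasure s \<delta> (\<Union>i. V i) < ennreal e" .
  moreover have "open (\<Union>i. V i)"
    by (auto simp: V_def)
  moreover have "A \<subseteq> (\<Union>i. V i)"
  proof
    fix x assume "x \<in> A"
    then obtain i where "x \<in> U i"
      using U by auto
    then have "x \<in> V i"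
      unfolding V_def using r(1)[of i] by (auto intro!: bexI[of _ x])
    then show "x \<in> (\<Union>i. V i)"
      by blast
  qed
  ultimately show ?thesis
    by blast
qed

section \<open>Monotonicity of Hausdorff dimension\<close>

lemma dim_H_ge_minus_one: "-1 \<le> dim_H A"
  unfolding dim_H_def by (auto intro!: Inf_greatest simp: one_ereal_def)

lemma dim_H_nonneg: "A \<noteq> {} \<Longrightarrow> 0 \<le> dim_H A"
  unfolding dim_H_def by (auto intro!: Inf_greatest)

lemma dim_H_mono:
  assumes "A \<subseteq> B"
  shows "dim_H A \<le> dim_H B"
proof (cases "A = {}")
  case True
  then show ?thesis
    using dim_H_ge_minus_one[of B] by (simp add: dim_H_def[of "{}"])
next
  case False
  then show ?thesis
    using assms hausdorff_null_subset[OF _ assms] by (auto simp: dim_H_def intro!: Inf_superset_mono)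
qed

lemma dim_H_le_expansion:
  assumes "c > 0" and expand: "\<And>x y. x \<in> A \<Longrightarrow> y \<in> A \<Longrightarrow> c * dist x y \<le> dist (h x) (h y)"
  shows "dim_H A \<le> dim_H (h ` A)"
proof (cases "A = {}")
  case False
  have "hausdorff_measure s A = 0" if s: "0 \<le> s" and null: "hausdorff_measure s (h ` A) = 0" for s
    unfolding hausdorff_measure_eq_0_iff
  proof (intro allI impI)
    fix \<delta> :: real assume "\<delta> > 0"
    have "hausdorff_premeasure s \<delta> A \<le> 0 + ennreal e" if "e > 0" for e
    proof -
      \<comment> \<open>Pulling back turns mesh \<open>c * \<delta>\<close> into
        \<open>\<delta>\<close> and multiplies costs by at most \<open>c powr - s\<close>, leaving
        \<open>e\<close>.\<close>
      have "hausdorff_premeasure s (c * \<delta>) (h ` A) < ennreal (e * c powr s)"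
        using null \<open>\<delta> > 0\<close> \<open>c > 0\<close> \<open>e > 0\<close> unfolding hausdorff_measure_eq_0_iff by simp
      from hausdorff_premeasure_lessE[OF this] obtain V where
        V: "h ` A \<subseteq> (\<Union>i. V i)" "\<And>i::nat. bounded (V i)" "\<And>i. diameter (V i) \<le> c * \<delta>"
          "(\<Sum>i. diam_pow s (V i)) < ennreal (e * c powr s)"
        by blast
      define U where "U i = {x \<in> A. h x \<in> V i}" for i
      have dU: "dist x y \<le> diameter (V i) / c" if "x \<in> U i" "y \<in> U i" for x y i
      proof -
        have "c * dist x y \<le> dist (h x) (h y)"
          using expand that by (auto simp: U_def)
        also have "\<dots> \<le> diameter (V i)"
          using that V(2) by (intro diameter_bounded_bound) (auto simp: U_def)
        finally show ?thesis
          using \<open>c > 0\<close> by (simp add: field_simps)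
      qed
      have V0: "0 \<le> diameter (V i) / c" for i
        using diameter_ge_0[OF V(2)] \<open>c > 0\<close> by simp
      have diamU: "diameter (U i) \<le> diameter (V i) / c" for i
        by (rule diameter_leI[OF V0 dU])
      have bU: "bounded (U i)" for i
        by (rule bounded_if_dist_le[OF dU])
      have "hausdorff_premeasure s \<delta> A \<le> (\<Sum>i. diam_pow s (U i))"
      proof (rule hausdorff_premeasure_le)
        show "diameter (U i) \<le> \<delta>" for i
        proof -
          have "diameter (V i) / c \<le> \<delta>"
            using V(3)[of i] \<open>c > 0\<close> by (simp add: field_simps)
          then show ?thesis
            using diamU[of i] by linarith
        qed
      qed (use V(1) bU in \<open>auto simp: U_def\<close>)
      also have "\<dots> \<le> (\<Sum>i. ennreal (c powr - s) * diam_pow s (V i))"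
      proof (intro suminf_le summableI)
        fix i
        show "diam_pow s (U i) \<le> ennreal (c powr - s) * diam_pow s (V i)"
        \<comment> \<open>For \<open>s = 0\<close> every non-empty set costs \<open>1\<close>, and
          \<open>V i\<close> is non-empty whenever \<open>U i\<close> is.\<close>
        proof (cases "U i = {} \<or> s = 0")
          case True
          then show ?thesis
            using \<open>c > 0\<close> by (auto simp: diam_pow_def U_def)
        next
          case False
          then have "V i \<noteq> {}"
            by (auto simp: U_def)
          have "diameter (U i) powr s \<le> (diameter (V i) / c) powr s"
            using diameter_ge_0[OF bU] diamU s by (intro powr_mono2) auto
          also have "\<dots> = c powr - s * diameter (V i) powr s"
            using \<open>c > 0\<close> diameter_ge_0[OF V(2)] by (simp add: powr_divide powr_minus_divide)
          finally show ?thesis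
            using False \<open>V i \<noteq> {}\<close> by (simp add: diam_pow_def ennreal_leI flip: ennreal_mult)
        qed
      qed
      also have "\<dots> = ennreal (c powr - s) * (\<Sum>i. diam_pow s (V i))"
        by simp
      also have "\<dots> \<le> ennreal (c powr - s) * ennreal (e * c powr s)"
        using V(4) by (intro mult_left_mono) auto
      also have "\<dots> = ennreal e"
        using \<open>c > 0\<close> \<open>e > 0\<close> by (simp add: powr_minus field_simps flip: ennreal_mult)
      finally show ?thesis
        by simp
    qed
    then have "hausdorff_premeasure s \<delta> A \<le> 0"
      by (rule ennreal_le_epsilon)
    then show "hausdorff_premeasure s \<delta> A = 0"
      by simp
  qed
  then show ?thesis
    using False by (auto simp: dim_H_def intro!: Inf_superset_mono)
qed (simp add: dim_H_def)

section \<open>Genericity\<close>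

lemma nowhere_dense_in_subset:
  "nowhere_dense_in X N \<Longrightarrow> N' \<subseteq> N \<Longrightarrow> nowhere_dense_in X N'"
  unfolding nowhere_dense_in_def using closure_of_mono interior_of_mono by (metis order_trans subset_empty)

text \<open>A non-empty interior of the closure would meet \<open>N\<close>. An open set inside it
  that misses \<open>N\<close> also misses the closure of \<open>N\<close>, a contradiction. Hence
  only open sets around points of \<open>N\<close> have to be tested.\<close>

lemma nowhere_dense_inI:
  assumes "N \<subseteq> topspace X"
    and "\<And>T z. \<lbrakk>openin X T; z \<in> T; z \<in> N\<rbrakk> \<Longrightarrow> \<exists>T'. openin X T' \<and> T' \<noteq> {} \<and> T' \<subseteq> T \<and> T' \<inter> N = {}"
  shows "nowhere_dense_in X N"
proof -
  let ?I = "X interior_of (X closure_of N)"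
  have "False" if "?I \<noteq> {}"
  proof -
    have "?I \<inter> N \<noteq> {}"
      using that interior_of_subset[of X "X closure_of N"] openin_Int_closure_of_eq_empty[of X ?I N] by auto
    then obtain z where "z \<in> ?I" "z \<in> N"
      by auto
    with assms(2) obtain T' where T': "openin X T'" "T' \<noteq> {}" "T' \<subseteq> ?I" "T' \<inter> N = {}"
      by (metis openin_interior_of)
    then have "T' \<inter> X closure_of N = {}"
      by (simp add: openin_Int_closure_of_eq_empty)
    then show False
      using T' interior_of_subset[of X "X closure_of N"] by blast
  qed
  then show ?thesis
    using assms(1) by (auto simp: nowhere_dense_in_def)
qed

text \<open>\<open>generic_in\<close> asks for equality with the exceptional set, so the sets of the
  family are cut down to it; subsets stay nowhere dense.\<close>

lemma generic_inI:
  assumes "countable \<N>" "\<And>N. N \<in> \<N> \<Longrightarrow> nowhere_dense_in X N"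
    and "\<And>z. \<lbrakk>z \<in> topspace X; z \<notin> \<Union>\<N>\<rbrakk> \<Longrightarrow> P z"
  shows "generic_in X P"
  unfolding generic_in_def
proof (intro exI conjI)
  let ?B = "{z \<in> topspace X. \<not> P z}"
  show "countable ((\<lambda>N. N \<inter> ?B) ` \<N>)"
    using assms(1) by simp
  show "\<forall>N\<in>(\<lambda>N. N \<inter> ?B) ` \<N>. nowhere_dense_in X N"
    using assms(2) by (auto intro: nowhere_dense_in_subset)
  show "?B = \<Union>((\<lambda>N. N \<inter> ?B) ` \<N>)"
    using assms(3) by blast
qed

section \<open>The space of continuous functions\<close>

lemma mspace_C_space:
  assumes "compact K"
  shows "f \<in> mspace (C_space K) \<longleftrightarrow> f \<in> extensional K \<and> continuous_on K f"
proof -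
  have "Met_TC.mbounded (f ` K)" if "continuous_on K f"
    using compact_continuous_image[OF that assms] by (simp add: compact_imp_bounded)
  then show ?thesis
    by (auto simp: C_space_def)
qed

lemma mdist_C_space_le:
  assumes "0 \<le> d" "\<And>x. x \<in> K \<Longrightarrow> \<bar>f x - g x\<bar> \<le> d"
  shows "mdist (C_space K) f g \<le> d"
  unfolding C_space_def by (rule mdist_cfunspace_le) (use assms in \<open>auto simp: dist_real_def\<close>)

lemma abs_diff_le_mdist_C_space:
  assumes "f \<in> mspace (C_space K)" "g \<in> mspace (C_space K)" "x \<in> K"
  shows "\<bar>f x - g x\<bar> \<le> mdist (C_space K) f g"
proof -
  \<comment> \<open>With the distance itself as the bound, the left side is trivial and the right
    side is the pointwise estimate.\<close>
  have "mdist (C_space K) f g \<le> mdist (C_space K) f g \<longleftrightarrow>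
      (\<forall>x\<in>topspace (top_of_set K). mdist euclidean_metric (f x) (g x) \<le> mdist (C_space K) f g)"
    using assms unfolding C_space_def by (intro cfunspace_mdist_le) auto
  then show ?thesis
    using assms(3) by (simp add: dist_real_def)
qed

text \<open>Reduces nowhere density in \<open>C_space K\<close> to uniform estimates on
  \<open>K\<close>, so that perturbations can be arbitrary functions on the type.\<close>

lemma nowhere_dense_in_C_spaceI:
  assumes "compact K" "N \<subseteq> mspace (C_space K)"
    and "\<And>f e. \<lbrakk>f \<in> N; e > 0\<rbrakk> \<Longrightarrow> \<exists>g d. d > 0 \<and> continuous_on K g \<and> (\<forall>x\<in>K. \<bar>g x - f x\<bar> \<le> e) \<and>
       (\<forall>h\<in>N. \<not> (\<forall>x\<in>K. \<bar>h x - g x\<bar> \<le> d))"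
  shows "nowhere_dense_in (mtopology_of (C_space K)) N"
proof (rule nowhere_dense_inI)
  show "N \<subseteq> topspace (mtopology_of (C_space K))"
    using assms by simp
next
  let ?M = "C_space K"
  interpret M: Metric_space "mspace ?M" "mdist ?M"
    by simp
  have top: "mtopology_of ?M = M.mtopology"
    by (simp add: mtopology_of_def)
  fix T f assume T: "openin (mtopology_of ?M) T" and f: "f \<in> T" "f \<in> N"
  then obtain e where e: "e > 0" "M.mball f e \<subseteq> T"
    unfolding top M.openin_mtopology by blast
  from assms(3)[OF f(2), of "e/2"] e obtain g d where g: "d > 0" "continuous_on K g"
      "\<And>x. x \<in> K \<Longrightarrow> \<bar>g x - f x\<bar> \<le> e/2" "\<And>h. h \<in> N \<Longrightarrow> \<not> (\<forall>x\<in>K. \<bar>h x - g x\<bar> \<le> d)"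
    by (metis half_gt_zero)
  \<comment> \<open>Elements of the function space must be \<open>undefined\<close> off
    \<open>K\<close>.\<close>
  define g' where "g' = restrict g K"
  have g'x: "g' x = g x" if "x \<in> K" for x
    using that by (simp add: g'_def)
  have g': "g' \<in> mspace ?M"
    using g(2) by (simp add: mspace_C_space[OF assms(1)] g'_def cong: continuous_on_cong)
  have fM: "f \<in> mspace ?M"
    using assms(2) f by auto
  have fg: "mdist ?M f g' \<le> e/2"
    using g(3) e by (intro mdist_C_space_le) (auto simp: g'_def abs_minus_commute)
  \<comment> \<open>Radius at most \<open>e/2\<close> around a point within \<open>e/2\<close> of
    \<open>f\<close> stays in the \<open>e\<close>-ball.\<close>
  let ?T = "M.mball g' (min d (e/2))"
  show "\<exists>T'. openin (mtopology_of ?M) T' \<and> T' \<noteq> {} \<and> T' \<subseteq> T \<and> T' \<inter> N = {}"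
  proof (intro exI[of _ ?T] conjI)
    show "openin (mtopology_of ?M) ?T"
      unfolding top by (rule M.openin_mball)
    have "g' \<in> ?T"
      using g' g e by simp
    then show "?T \<noteq> {}"
      by blast
    show "?T \<subseteq> T"
    proof
      fix h assume h: "h \<in> ?T"
      then have "mdist ?M f h \<le> mdist ?M f g' + mdist ?M g' h"
        using fM g' by (intro M.triangle) auto
      then have "h \<in> M.mball f e"
        using h fg fM by auto
      then show "h \<in> T"
        using e by blast
    qed
    show "?T \<inter> N = {}"
    proof -
      have "h \<notin> N" if h: "h \<in> ?T" for h
      proof -
        have "\<bar>h x - g x\<bar> \<le> d" if "x \<in> K" for x
          using abs_diff_le_mdist_C_space[OF g', of h x] h that by (auto simp: g'x abs_minus_commute)
        then show ?thesis
          using g(4) by blast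
      qed
      then show ?thesis
        by blast
    qed
  qed
qed

section \<open>Topological Hausdorff dimension\<close>

text \<open>All open sets with small frontier together form a base, so \<open>s + 1\<close> is among
  the values of the infimum.\<close>

lemma dim_tH_leI:
  assumes "X \<noteq> {}"
    and "\<And>x e. \<lbrakk>x \<in> X; e > 0\<rbrakk> \<Longrightarrow> \<exists>U. openin (top_of_set X) U \<and> x \<in> U \<and> U \<subseteq> ball x e \<and>
      dim_H (top_of_set X frontier_of U) \<le> ereal s"
  shows "dim_tH X \<le> ereal (s + 1)"
proof -
  let ?U = "{U. openin (top_of_set X) U \<and> dim_H (top_of_set X frontier_of U) \<le> ereal s}"
  have "base_of (top_of_set X) ?U"
    unfolding base_of_def openin_topology_base_unique
  proof (intro conjI allI impI)
    fix V x assume V: "openin (top_of_set X) V \<and> x \<in> V"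
    then obtain e where e: "e > 0" "ball x e \<inter> X \<subseteq> V" "x \<in> X"
      by (metis openin_contains_ball subsetD)
    with assms(2)[of x e] obtain U where "openin (top_of_set X) U" "x \<in> U" "U \<subseteq> ball x e"
        "dim_H (top_of_set X frontier_of U) \<le> ereal s"
      by blast
    moreover from this have "U \<subseteq> V"
      using e openin_imp_subset by blast
    ultimately show "\<exists>W. W \<in> ?U \<and> x \<in> W \<and> W \<subseteq> V"
      by blast
  qed auto
  moreover have "ereal (s + 1) - 1 = ereal s"
    by (simp add: one_ereal_def)
  ultimately show ?thesis
    using assms(1) unfolding dim_tH_def by (auto intro!: Inf_lower exI[of _ ?U])
qed

text \<open>Some admissible \<open>d\<close> lies strictly below \<open>s + 1\<close>. The resulting
  strict bound on the frontier is what later makes it \<open>s\<close>-null.\<close>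

lemma dim_tH_lessD:
  assumes "X \<noteq> {}" "dim_tH X < ereal (s + 1)" "openin (top_of_set X) V" "x \<in> V"
  shows "\<exists>U. openin (top_of_set X) U \<and> x \<in> U \<and> U \<subseteq> V \<and> dim_H (top_of_set X frontier_of U) < ereal s"
proof -
  obtain d \<U> where d: "d < ereal (s + 1)" "base_of (top_of_set X) \<U>"
      "\<And>U. U \<in> \<U> \<Longrightarrow> dim_H (top_of_set X frontier_of U) \<le> d - 1"
    using assms(1,2) by (auto simp: dim_tH_def Inf_less_iff)
  obtain U where U: "U \<in> \<U>" "x \<in> U" "U \<subseteq> V"
    using d(2) assms(3,4) unfolding base_of_def openin_topology_base_unique by metis
  moreover have "openin (top_of_set X) U"
    using d(2) U(1) unfolding base_of_def openin_topology_base_unique by metis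
  moreover have "d - 1 < ereal s"
    using d(1) by (cases d) (auto simp: one_ereal_def)
  ultimately show ?thesis
    using d(3)[OF U(1)] by (meson le_less_trans)
qed

text \<open>If \<open>dim_tH X < 1\<close>, there is a base whose frontiers have negative Hausdorff
  dimension, hence are empty. Such a clopen base gives \<open>dim_t \<le> 0\<close>.\<close>

lemma dim_tH_ge_1:
  assumes "dim_t (top_of_set X) > 0"
  shows "dim_tH X \<ge> 1"
proof (rule ccontr)
  assume "\<not> 1 \<le> dim_tH X"
  then have less: "dim_tH X < ereal (0 + 1)"
    by (simp add: one_ereal_def not_le)
  have ne: "X \<noteq> {}"
  proof
    assume "X = {}"
    then have "dim_t (top_of_set X) = -1"
      by (intro dim_t_empty) simp
    then show False
      using assms by simp
  qed
  let ?U = "{U. openin (top_of_set X) U \<and> top_of_set X frontier_of U = {}}"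
  have "base_of (top_of_set X) ?U"
    unfolding base_of_def openin_topology_base_unique
  proof (intro conjI allI impI)
    fix V x assume "openin (top_of_set X) V \<and> x \<in> V"
    with dim_tH_lessD[OF ne less] obtain U where U: "openin (top_of_set X) U" "x \<in> U" "U \<subseteq> V"
        "dim_H (top_of_set X frontier_of U) < ereal 0"
      by blast
    then have "top_of_set X frontier_of U = {}"
      using dim_H_nonneg by (metis not_le zero_ereal_def)
    with U show "\<exists>W. W \<in> ?U \<and> x \<in> W \<and> W \<subseteq> V"
      by blast
  qed auto
  moreover have "dim_t (subtopology (top_of_set X) {}) \<le> 0 - 1"
    by (simp add: dim_t_empty)
  ultimately have "dim_t (top_of_set X) \<le> 0"
    using ne by (subst dim_t_nonempty) (auto intro!: Inf_lower exI[of _ ?U])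
  then show False
    using assms by simp
qed

section \<open>Lower bound\<close>

text \<open>The ratio may be \<open>1\<close>, so that the identity counts as the empty
  composition.\<close>

definition similitude_on :: "real \<Rightarrow> 'a::metric_space set \<Rightarrow> ('a \<Rightarrow> 'a) \<Rightarrow> bool" where
  "similitude_on r K h \<longleftrightarrow> 0 < r \<and> h ` K \<subseteq> K \<and> (\<forall>x\<in>K. \<forall>y\<in>K. dist (h x) (h y) = r * dist x y)"

text \<open>The images of \<open>K\<close> under all \<open>m\<close>-fold compositions of the given
  maps cover \<open>K\<close>. Their ratios are at most \<open>R ^ m\<close>, where
  \<open>R < 1\<close> is the largest ratio.\<close>

lemma self_similar_small_copies:
  fixes K :: "'a::metric_space set"
  assumes "bounded K" "self_similar K" "e > 0"
  shows "\<exists>\<Psi>. finite \<Psi> \<and> (\<forall>h\<in>\<Psi>. \<exists>r. similitude_on r K h) \<and> K \<subseteq> (\<Union>h\<in>\<Psi>. h ` K) \<and>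
    (\<forall>h\<in>\<Psi>. \<forall>x\<in>h ` K. \<forall>y\<in>h ` K. dist x y < e)"
proof (cases "K = {}")
  case False
  obtain k :: nat and \<phi> where \<phi>: "\<And>i. i < k \<Longrightarrow> contractive_similitude K (\<phi> i)" "K = (\<Union>i<k. \<phi> i ` K)"
    using assms(2) by (auto simp: self_similar_def)
  have "\<forall>i. \<exists>r. i < k \<longrightarrow> 0 < r \<and> r < 1 \<and> (\<forall>x\<in>K. \<forall>y\<in>K. dist (\<phi> i x) (\<phi> i y) = r * dist x y)"
    using \<phi>(1) unfolding contractive_similitude_def by blast
  then obtain r where r: "\<And>i. i < k \<Longrightarrow> 0 < r i" "\<And>i. i < k \<Longrightarrow> r i < 1"
      "\<And>i x y. \<lbrakk>i < k; x \<in> K; y \<in> K\<rbrakk> \<Longrightarrow> dist (\<phi> i x) (\<phi> i y) = r i * dist x y"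
    by metis
  have maps: "\<phi> i ` K \<subseteq> K" if "i < k" for i
    using \<phi>(1)[OF that] unfolding contractive_similitude_def by blast
  have "k > 0"
    using False \<phi>(2) by (cases k) auto
  define R where "R = Max (r ` {..<k})"
  have rR: "r i \<le> R" if "i < k" for i
    using that by (auto simp: R_def)
  have "R \<in> r ` {..<k}"
    unfolding R_def using \<open>k > 0\<close> by (intro Max_in) auto
  then have R: "0 < R" "R < 1"
    using r by auto
  have "\<exists>\<Psi>. finite \<Psi> \<and> (\<forall>h\<in>\<Psi>. \<exists>q. similitude_on q K h \<and> q \<le> R ^ m) \<and> K \<subseteq> (\<Union>h\<in>\<Psi>. h ` K)" for m
  proof (induction m)
    case 0
    show ?case
      by (intro exI[of _ "{id}"]) (auto simp: similitude_on_def intro!: exI[of _ 1])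
  next
    case (Suc m)
    then obtain \<Psi> where \<Psi>: "finite \<Psi>" "\<And>h. h \<in> \<Psi> \<Longrightarrow> \<exists>q. similitude_on q K h \<and> q \<le> R ^ m"
        "K \<subseteq> (\<Union>h\<in>\<Psi>. h ` K)"
      by blast
    let ?\<Psi> = "(\<lambda>(i, h). \<phi> i \<circ> h) ` ({..<k} \<times> \<Psi>)"
    have "\<exists>q. similitude_on q K (\<phi> i \<circ> h) \<and> q \<le> R ^ Suc m" if "i < k" "h \<in> \<Psi>" for i h
    proof -
      obtain q where q: "similitude_on q K h" "q \<le> R ^ m"
        using \<Psi>(2)[OF \<open>h \<in> \<Psi>\<close>] by blast
      have hK: "h x \<in> K" if "x \<in> K" for x
        using q(1) that by (auto simp: similitude_on_def)
      have "similitude_on (r i * q) K (\<phi> i \<circ> h)"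
        unfolding similitude_on_def
      proof (intro conjI ballI)
        show "0 < r i * q"
          using q(1) r(1) \<open>i < k\<close> by (simp add: similitude_on_def)
        show "(\<phi> i \<circ> h) ` K \<subseteq> K"
          using hK maps[OF \<open>i < k\<close>] by auto
        fix x y assume "x \<in> K" "y \<in> K"
        then show "dist ((\<phi> i \<circ> h) x) ((\<phi> i \<circ> h) y) = r i * q * dist x y"
          using q(1) r(3)[OF \<open>i < k\<close> hK[of x] hK[of y]] by (simp add: similitude_on_def)
      qed
      moreover have "r i * q \<le> R * R ^ m"
        using q r(1)[OF \<open>i < k\<close>] rR[OF \<open>i < k\<close>] R
        by (intro mult_mono) (auto simp: similitude_on_def)
      ultimately show ?thesis
        by (intro exI[of _ "r i * q"]) simp
    qed
    moreover have "K \<subseteq> (\<Union>h\<in>?\<Psi>. h ` K)"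
    proof
      fix x assume "x \<in> K"
      then obtain i z where "i < k" "z \<in> K" "x = \<phi> i z"
        using \<phi>(2) by blast
      moreover from \<open>z \<in> K\<close> obtain h w where "h \<in> \<Psi>" "w \<in> K" "z = h w"
        using \<Psi>(3) by blast
      ultimately show "x \<in> (\<Union>h\<in>?\<Psi>. h ` K)"
        by (intro UN_I[of "\<phi> i \<circ> h"]) auto
    qed
    ultimately show ?case
      using \<Psi>(1) by (intro exI[of _ ?\<Psi>]) auto
  qed
  note copies = this
  obtain m where m: "R ^ m * (diameter K + 1) < e"
  proof -
    have "(\<lambda>m. R ^ m * (diameter K + 1)) \<longlonglongrightarrow> 0 * (diameter K + 1)"
      using R by (intro tendsto_intros LIMSEQ_power_zero) auto
    then have "\<forall>\<^sub>F m in sequentially. R ^ m * (diameter K + 1) < e"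
      using assms(3) by (intro order_tendstoD(2)) auto
    then show ?thesis
      using that eventually_happens'[OF sequentially_bot] by blast
  qed
  obtain \<Psi> where \<Psi>: "finite \<Psi>" "\<And>h. h \<in> \<Psi> \<Longrightarrow> \<exists>q. similitude_on q K h \<and> q \<le> R ^ m"
      "K \<subseteq> (\<Union>h\<in>\<Psi>. h ` K)"
    using copies[of m] by (elim exE conjE) (rule that; blast)
  have "dist (h x) (h y) < e" if "h \<in> \<Psi>" "x \<in> K" "y \<in> K" for h x y
  proof -
    obtain q where q: "similitude_on q K h" "q \<le> R ^ m"
      using \<Psi>(2)[OF \<open>h \<in> \<Psi>\<close>] by blast
    have "dist (h x) (h y) = q * dist x y"
      using q that by (auto simp: similitude_on_def)
    also have "\<dots> \<le> R ^ m * (diameter K + 1)"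
      using diameter_bounded_bound[OF assms(1) that(2,3)] q R by (intro mult_mono) auto
    also note m
    finally show ?thesis .
  qed
  moreover have "\<exists>q. similitude_on q K h" if "h \<in> \<Psi>" for h
    using \<Psi>(2)[OF that] by blast
  ultimately show ?thesis
    using \<Psi>(1,3) by (intro exI[of _ \<Psi>]) auto
qed (intro exI[of _ "{}"], auto)

text \<open>The closure lies in \<open>dist z x \<le> d\<close> and \<open>g z \<ge> c\<close>. The
  sphere of radius \<open>d\<close> is excluded by \<open>out\<close>, so a frontier point is inside
  the ball and fails only \<open>g z > c\<close>.\<close>

lemma frontier_superlevel_subset:
  fixes g :: "'a::metric_space \<Rightarrow> real"
  assumes "continuous_on K g" "x \<in> K" "c < g x" "d > 0"
    and out: "\<And>z. \<lbrakk>z \<in> K; dist z x = d\<rbrakk> \<Longrightarrow> g z < c"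
  shows "openin (top_of_set K) {z \<in> K. dist z x < d \<and> g z > c}"
    and "top_of_set K frontier_of {z \<in> K. dist z x < d \<and> g z > c} \<subseteq> {z \<in> K. g z = c}"
proof -
  let ?U = "{z \<in> K. dist z x < d \<and> g z > c}"
  have cd: "continuous_on K (\<lambda>z. dist z x)"
    by (intro continuous_intros)
  have "?U = (K \<inter> (\<lambda>z. dist z x) -` {..<d}) \<inter> (K \<inter> g -` {c<..})"
    by auto
  then show op: "openin (top_of_set K) ?U"
    using assms(1) cd by (auto intro!: openin_Int continuous_openin_preimage_gen)
  let ?C = "(K \<inter> (\<lambda>z. dist z x) -` {..d}) \<inter> (K \<inter> g -` {c..})"
  have "closedin (top_of_set K) ?C"
    using assms(1) cd by (intro closedin_Int continuous_closedin_preimage) auto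
  then have "top_of_set K closure_of ?U \<subseteq> ?C"
    by (intro closure_of_minimal) auto
  then have "top_of_set K frontier_of ?U \<subseteq> ?C - ?U"
    using op by (auto simp: frontier_of_openin)
  also have "\<dots> \<subseteq> {z \<in> K. g z = c}"
    using out by force
  finally show "top_of_set K frontier_of ?U \<subseteq> {z \<in> K. g z = c}" .
qed

text \<open>
  If these functions were dense near some \<open>f\<close>, then adding to \<open>f\<close> a small bump at \<open>h x\<close> and
  approximating would give a \<open>g\<close> with a level set of dimension at most \<open>s\<close> in \<open>h ` K\<close> that
  separates \<open>h x\<close> from the complement of a small ball; pulled back along \<open>h\<close>, such level sets
  bound a basis of \<open>K\<close>.
\<close>
lemma nowhere_dense_small_level_sets:
  fixes K :: "'a::metric_space set"
  assumes "compact K" "K \<noteq> {}" "similitude_on r K h" "ereal (s + 1) < dim_tH K"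
  shows "nowhere_dense_in (mtopology_of (C_space K))
    {f \<in> mspace (C_space K). \<forall>a b. a < b \<longrightarrow> (\<exists>c. a < c \<and> c < b \<and> dim_H {z \<in> h ` K. f z = c} \<le> ereal s)}"
    (is "nowhere_dense_in _ ?N")
proof -
  have r: "r > 0" "h ` K \<subseteq> K" "\<And>x y. \<lbrakk>x \<in> K; y \<in> K\<rbrakk> \<Longrightarrow> dist (h x) (h y) = r * dist x y"
    using assms(3) by (auto simp: similitude_on_def)
  show ?thesis
  proof (rule nowhere_dense_in_C_spaceI[OF assms(1)], blast, rule ccontr)
    fix f e assume f: "f \<in> ?N" and e: "(e::real) > 0"
    assume "\<nexists>g d. d > 0 \<and> continuous_on K g \<and> (\<forall>x\<in>K. \<bar>g x - f x\<bar> \<le> e) \<and>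
      (\<forall>h\<in>?N. \<not> (\<forall>x\<in>K. \<bar>h x - g x\<bar> \<le> d))"
    \<comment> \<open>The negated criterion: near \<open>f\<close>, every continuous function is a
      uniform limit of members of \<open>?N\<close>.\<close>
    then have dense: "\<exists>k\<in>?N. \<forall>x\<in>K. \<bar>k x - g x\<bar> \<le> d"
      if "d > 0" "continuous_on K g" "\<And>x. x \<in> K \<Longrightarrow> \<bar>g x - f x\<bar> \<le> e" for g d
      using that by blast
    have fc: "continuous_on K f"
      using f by (simp add: mspace_C_space[OF assms(1)])
    have "dim_tH K \<le> ereal (s + 1)"
    proof (rule dim_tH_leI[OF assms(2)])
      fix x \<epsilon> assume x: "x \<in> K" and "(\<epsilon>::real) > 0"
      have hx: "h x \<in> K"
        using r x by blast
      obtain \<delta>0 where \<delta>0: "\<delta>0 > 0" "\<And>z. \<lbrakk>z \<in> K; dist z (h x) < \<delta>0\<rbrakk> \<Longrightarrow> \<bar>f z - f (h x)\<bar> < e/8"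
        using fc[unfolded continuous_on_iff, rule_format, OF hx, of "e/8"] e by (auto simp: dist_real_def)
      \<comment> \<open>Strictly below \<open>\<delta>0\<close> so that the estimate holds on the
        sphere too; at most \<open>r * \<epsilon>\<close> because pulling back along
        \<open>h\<close> divides distances by \<open>r\<close>.\<close>
      define \<delta> where "\<delta> = min (\<delta>0/2) (r * \<epsilon>)"
      have \<delta>: "\<delta> > 0" "\<delta> < \<delta>0" "\<delta> \<le> r * \<epsilon>"
        using \<delta>0 \<open>\<epsilon> > 0\<close> r by (auto simp: \<delta>_def)
      \<comment> \<open>A tent of height \<open>e\<close> at \<open>h x\<close> that vanishes from
        distance \<open>\<delta>\<close> on.\<close>
      define g where "g z = f z + max 0 (e * (1 - dist z (h x) / \<delta>))" for z
      have gc: "continuous_on K g"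
        unfolding g_def using fc \<delta> by (intro continuous_intros) auto
      have "\<bar>g z - f z\<bar> \<le> e" for z
        using e \<delta> by (auto simp: g_def max_def mult_le_cancel_left1)
      then obtain k where k: "k \<in> ?N" "\<And>z. z \<in> K \<Longrightarrow> \<bar>k z - g z\<bar> \<le> e/8"
        using dense[of "e/8" g] gc e by auto
      \<comment> \<open>This range separates the centre from the sphere: \<open>k\<close> is at
        least \<open>f (h x) + 7*e/8\<close> at \<open>h x\<close>, and less than
        \<open>f (h x) + e/4\<close> at distance \<open>\<delta>\<close>.\<close>
      obtain c where c: "f (h x) + e/4 < c" "c < f (h x) + e/2"
          and dim: "dim_H {z \<in> h ` K. k z = c} \<le> ereal s"
      proof -
        have "f (h x) + e/4 < f (h x) + e/2"
          using e by simp
        then show ?thesis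
          using k(1) that by blast
      qed
      have "g (h x) = f (h x) + e"
        using e by (simp add: g_def)
      then have ck: "c < k (h x)"
        using k(2)[OF hx] c e unfolding abs_le_iff by linarith
      have out: "k z < c" if "z \<in> K" "dist z (h x) = \<delta>" for z
      proof -
        have "g z = f z"
          using that \<delta> by (simp add: g_def)
        moreover have "\<bar>f z - f (h x)\<bar> < e/8"
          using \<delta>0(2) that \<delta> by simp
        ultimately show ?thesis
          using k(2)[OF that(1)] c by linarith
      qed
      have kc: "continuous_on K k"
        using k(1) by (simp add: mspace_C_space[OF assms(1)])
      have "continuous_on K h"
        unfolding continuous_on_iff
      proof (intro ballI allI impI)
        fix u \<eta> assume "u \<in> K" "(\<eta>::real) > 0"
        then show "\<exists>d>0. \<forall>v\<in>K. dist v u < d \<longrightarrow> dist (h v) (h u) < \<eta>"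
          using r by (intro exI[of _ "\<eta> / r"]) (auto simp: field_simps)
      qed
      then have khc: "continuous_on K (k \<circ> h)"
        using kc r(2) by (intro continuous_on_compose continuous_on_subset[OF kc])
      let ?U = "{z \<in> K. dist z x < \<delta> / r \<and> (k \<circ> h) z > c}"
      have out': "(k \<circ> h) z < c" if "z \<in> K" "dist z x = \<delta> / r" for z
      proof -
        have "h z \<in> K"
          using that r(2) by blast
        moreover have "dist (h z) (h x) = \<delta>"
          using that r x by simp
        ultimately show ?thesis
          using out by simp
      qed
      have U: "openin (top_of_set K) ?U" "top_of_set K frontier_of ?U \<subseteq> {z \<in> K. (k \<circ> h) z = c}"
        by (rule frontier_superlevel_subset[OF khc x]; use out' ck \<delta> r in simp)+
      have "dim_H (top_of_set K frontier_of ?U) \<le> dim_H {z \<in> K. (k \<circ> h) z = c}"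
        by (rule dim_H_mono[OF U(2)])
      also have "\<dots> \<le> dim_H (h ` {z \<in> K. (k \<circ> h) z = c})"
        by (rule dim_H_le_expansion[OF r(1)]) (simp add: r(3))
      also have "\<dots> \<le> dim_H {z \<in> h ` K. k z = c}"
        by (rule dim_H_mono) auto
      also note dim
      finally have "dim_H (top_of_set K frontier_of ?U) \<le> ereal s" .
      moreover have "?U \<subseteq> ball x \<epsilon>"
      proof
        fix z assume "z \<in> ?U"
        then have "dist z x < \<delta> / r"
          by simp
        also have "\<dots> \<le> \<epsilon>"
          using \<delta> r by (simp add: field_simps)
        finally show "z \<in> ball x \<epsilon>"
          by (simp add: dist_commute)
      qed
      moreover have "x \<in> ?U"
        using x ck \<delta> r by simp
      ultimately show "\<exists>U. openin (top_of_set K) U \<and> x \<in> U \<and> U \<subseteq> ball x \<epsilon> \<and>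
          dim_H (top_of_set K frontier_of U) \<le> ereal s"
        using U(1) by blast
    qed
    then show False
      using assms(4) by simp
  qed
qed

section \<open>Upper bound\<close>

text \<open>
  Unlike \<open>s\<close>-nullity, this passes from a compact level set to all nearby level sets, because the
  cover is a neighbourhood.
\<close>
definition small_cover :: "real \<Rightarrow> real \<Rightarrow> 'a::metric_space set \<Rightarrow> bool" where
  "small_cover s \<delta> A \<longleftrightarrow> (\<exists>W. open W \<and> A \<subseteq> W \<and> hausdorff_premeasure s \<delta> W < ennreal \<delta>)"

text \<open>One parameter bounds both mesh and cost, so countably many conditions express nullity:
  take \<open>1 / Suc n\<close> below both \<open>\<delta>\<close> and \<open>e\<close>.\<close>

lemma hausdorff_null_if_small_cover:
  assumes "\<And>n::nat. small_cover s (1 / Suc n) A"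
  shows "hausdorff_measure s A = 0"
  unfolding hausdorff_measure_eq_0_iff
proof (intro allI impI)
  fix \<delta> :: real assume "\<delta> > 0"
  have "hausdorff_premeasure s \<delta> A \<le> 0 + ennreal e" if "e > 0" for e
  proof -
    have "min \<delta> e > 0"
      using \<open>\<delta> > 0\<close> that by simp
    then obtain n where n: "1 / real (Suc n) < min \<delta> e"
      using nat_approx_posE by blast
    obtain W where W: "A \<subseteq> W" "hausdorff_premeasure s (1 / Suc n) W < ennreal (1 / Suc n)"
      using assms unfolding small_cover_def by blast
    have "hausdorff_premeasure s \<delta> A \<le> hausdorff_premeasure s (1 / Suc n) A"
      using n by (intro hausdorff_premeasure_antimono) auto
    also have "\<dots> \<le> hausdorff_premeasure s (1 / Suc n) W"
      by (rule hausdorff_premeasure_mono[OF W(1)])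
    also have "\<dots> \<le> ennreal (1 / Suc n)"
      using W(2) by simp
    also have "\<dots> \<le> ennreal e"
      using n by (intro ennreal_leI) auto
    finally show ?thesis
      by simp
  qed
  then have "hausdorff_premeasure s \<delta> A \<le> 0"
    by (rule ennreal_le_epsilon)
  then show "hausdorff_premeasure s \<delta> A = 0"
    by simp
qed

text \<open>On the compact set \<open>K - W\<close> the function \<open>\<bar>g z - y\<bar>\<close>
  has a positive minimum, which serves as \<open>\<eta>\<close>.\<close>

lemma level_set_neighbourhood:
  fixes g :: "'a::metric_space \<Rightarrow> real"
  assumes "compact K" "continuous_on K g" "open W" "{z \<in> K. g z = y} \<subseteq> W"
  shows "\<exists>\<eta>>0. \<forall>z\<in>K. \<bar>g z - y\<bar> < \<eta> \<longrightarrow> z \<in> W"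
proof (cases "K - W = {}")
  case False
  have "compact (K - W)"
    using assms by (simp add: compact_diff)
  moreover have "continuous_on (K - W) (\<lambda>z. \<bar>g z - y\<bar>)"
    using assms(2) by (intro continuous_intros continuous_on_subset[OF assms(2)]) auto
  ultimately obtain x where x: "x \<in> K - W" "\<And>z. z \<in> K - W \<Longrightarrow> \<bar>g x - y\<bar> \<le> \<bar>g z - y\<bar>"
    using continuous_attains_inf[OF _ False] by metis
  then show ?thesis
    using assms(4) by (intro exI[of _ "\<bar>g x - y\<bar>"]) force
qed (intro exI[of _ 1], auto)

text \<open>
  Finitely many basic sets form an open \<open>U\<close> between \<open>{f \<ge> f x + e/2}\<close> and \<open>{f > f x - e/2}\<close>
  whose frontier is null. The perturbed function is above the value \<open>f x\<close> on \<open>U\<close> and below it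
  off \<open>U\<close>, except on the frontier of \<open>U\<close> and at \<open>x\<close>.
\<close>
lemma perturb_to_null_level_set:
  fixes K :: "'a::metric_space set" and f :: "'a \<Rightarrow> real"
  assumes "compact K" "s > 0" "dim_tH K < ereal (s + 1)" "continuous_on K f" "x \<in> K" "e > 0"
  shows "\<exists>g. continuous_on K g \<and> g x = f x \<and> (\<forall>z\<in>K. \<bar>g z - f z\<bar> \<le> e) \<and>
    hausdorff_measure s {z \<in> K. g z = f x} = 0"
proof -
  \<comment> \<open>The perturbation has two parts, \<open>p\<close> and the replacement of
    \<open>h\<close> by \<open>T\<close>; each contributes at most \<open>\<eta>\<close>.\<close>
  define \<eta> where "\<eta> = e / 2"
  have \<eta>: "\<eta> > 0"
    using assms by (simp add: \<eta>_def)
  define h where "h z = f z - f x" for z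
  have hc: "continuous_on K h"
    unfolding h_def using assms(4) by (intro continuous_intros)
  let ?X = "top_of_set K"
  define V where "V = {z \<in> K. h z > -\<eta>}"
  define \<F> where "\<F> = {U. openin ?X U \<and> U \<subseteq> V \<and> dim_H (?X frontier_of U) < ereal s}"
  let ?L = "{z \<in> K. h z < \<eta>}"
  have "V = K \<inter> h -` {-\<eta><..}" "?L = K \<inter> h -` {..<\<eta>}"
    by (auto simp: V_def)
  then have op: "openin ?X V" "openin ?X ?L"
    using hc by (auto intro: continuous_openin_preimage_gen)
  \<comment> \<open>Points outside \<open>?L\<close> lie in \<open>V\<close> and so in a member of
    \<open>\<F>\<close>; compactness leaves finitely many members.\<close>
  have "\<forall>c\<in>insert ?L \<F>. openin ?X c"
    using op by (auto simp: \<F>_def)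
  moreover have "K \<subseteq> \<Union>(insert ?L \<F>)"
  proof
    fix z assume z: "z \<in> K"
    show "z \<in> \<Union>(insert ?L \<F>)"
    proof (cases "h z < \<eta>")
      case False
      then have "z \<in> V"
        using z \<eta> by (auto simp: V_def)
      then show ?thesis
        using dim_tH_lessD[OF _ assms(3) op(1), of z] z unfolding \<F>_def by blast
    qed (use z in auto)
  qed
  ultimately obtain \<D> where \<D>: "\<D> \<subseteq> insert ?L \<F>" "finite \<D>" "K \<subseteq> \<Union>\<D>"
    using assms(1) unfolding compact_eq_openin_cover by meson
  define U where "U = \<Union>(\<D> \<inter> \<F>)"
  have opU: "openin ?X U"
    unfolding U_def by (rule openin_Union) (auto simp: \<F>_def)
  have UK: "U \<subseteq> K"
    using opU by (rule openin_imp_subset)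
  have hU: "h z > -\<eta>" if "z \<in> U" for z
    using that by (auto simp: U_def \<F>_def V_def)
  have hnU: "h z < \<eta>" if "z \<in> K" "z \<notin> U" for z
  proof -
    obtain T where "T \<in> \<D>" "z \<in> T"
      using \<D>(3) \<open>z \<in> K\<close> by blast
    moreover from this have "T \<notin> \<F>"
      using \<open>z \<notin> U\<close> by (auto simp: U_def)
    ultimately show ?thesis
      using \<D>(1) by blast
  qed
  \<comment> \<open>Including \<open>x\<close> forces the perturbed function to keep its value
    there.\<close>
  define G where "G = insert x (?X frontier_of U)"
  have nullG: "hausdorff_measure s G = 0"
  proof -
    have "hausdorff_measure s (\<Union>T\<in>\<D> \<inter> \<F>. ?X frontier_of T) = 0"
      using \<D>(2) assms(2) by (intro hausdorff_null_UN) (auto simp: \<F>_def intro: hausdorff_null_if_dim_H_less)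
    moreover have "?X frontier_of U \<subseteq> (\<Union>T\<in>\<D> \<inter> \<F>. ?X frontier_of T)"
      unfolding U_def using \<D>(2) by (intro frontier_of_Union_subset) auto
    ultimately have "hausdorff_measure s (?X frontier_of U) = 0"
      by (rule hausdorff_null_subset)
    from hausdorff_null_Un[OF hausdorff_null_singleton[OF assms(2)] this, of x] show ?thesis
      by (simp add: G_def)
  qed
  have "closed (?X frontier_of U)"
    using closedin_closed_trans[OF closedin_frontier_of] compact_imp_closed[OF assms(1)] by blast
  then have "closed G"
    by (simp add: G_def closed_insert)
  then have inG: "z \<in> G" if "infdist z G = 0" for z
    using that in_closed_iff_infdist_zero[of G z] by (auto simp: G_def)
  define \<rho> where "\<rho> z = min \<eta> (infdist z G)" for z
  have \<rho>: "0 \<le> \<rho> z" "\<rho> z \<le> \<eta>" for z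
    using \<eta> infdist_nonneg[of z G] by (auto simp: \<rho>_def)
  have \<rho>0: "\<rho> z = 0 \<longleftrightarrow> z \<in> G" for z
    using \<eta> inG infdist_zero[of z G] by (auto simp: \<rho>_def min_def split: if_splits)
  have \<rho>c: "continuous_on S \<rho>" for S
    unfolding \<rho>_def by (intro continuous_intros)
  \<comment> \<open>Signed distance to \<open>G\<close>, capped at \<open>\<eta>\<close>: the sign
    jumps only across the frontier of \<open>U\<close>, where \<open>\<rho>\<close> vanishes, so
    \<open>p\<close> is continuous.\<close>
  define p where "p z = (if z \<in> U then \<rho> z else - \<rho> z)" for z
  have pc: "continuous_on K p"
  proof -
    let ?A = "?X closure_of U"
    have AB: "?A \<union> (K - U) = K"
      using closure_of_subset_topspace[of ?X U] closure_of_subset[of U ?X] UK by auto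
    have "continuous_on (?A \<union> (K - U)) p"
      unfolding p_def
    proof (rule continuous_on_cases_local)
      show "closedin (top_of_set (?A \<union> (K - U))) ?A"
        unfolding AB by simp
      show "closedin (top_of_set (?A \<union> (K - U))) (K - U)"
        unfolding AB using opU closedin_diff[OF closedin_topspace opU] by simp
      show "\<rho> z = - \<rho> z" if "z \<in> ?A \<and> z \<notin> U \<or> z \<in> K - U \<and> z \<in> U" for z
      proof -
        have "z \<in> ?X frontier_of U"
          using that opU by (auto simp: frontier_of_openin)
        then have "\<rho> z = 0"
          using \<rho>0 by (simp add: G_def)
        then show ?thesis
          by simp
      qed
    qed (intro continuous_on_minus \<rho>c)+
    then show ?thesis
      unfolding AB .
  qed
  \<comment> \<open>Soft thresholding: zero on \<open>[-\<eta>, \<eta>]\<close>, within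
    \<open>\<eta>\<close> of the identity, non-negative for \<open>t > -\<eta>\<close> and
    non-positive for \<open>t < \<eta>\<close>.\<close>
  define T where "T t = max (t - \<eta>) 0 + min (t + \<eta>) 0" for t
  define g where "g z = f x + p z + T (h z)" for z
  show ?thesis
  proof (intro exI[of _ g] conjI ballI)
    show "continuous_on K g"
      unfolding g_def T_def using pc hc by (intro continuous_intros)
    show "g x = f x"
      using \<rho>0[of x] \<eta> by (simp add: g_def p_def T_def h_def G_def)
    fix z assume "z \<in> K"
    have "\<bar>T (h z) - h z\<bar> \<le> \<eta>" "\<bar>p z\<bar> \<le> \<eta>"
      using \<eta> \<rho>[of z] by (auto simp: T_def p_def)
    then show "\<bar>g z - f z\<bar> \<le> e"
      using h_def[of z] \<eta>_def unfolding g_def by linarith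
  next
    \<comment> \<open>On and off \<open>U\<close> the terms \<open>p z\<close> and
      \<open>T (h z)\<close> have no opposite signs, so a zero sum forces
      \<open>\<rho> z = 0\<close>.\<close>
    have "z \<in> G" if z: "z \<in> K" "g z = f x" for z
    proof (cases "z \<in> U")
      case True
      then have "T (h z) \<ge> 0" "p z = \<rho> z"
        using hU[of z] by (auto simp: T_def p_def)
      then show ?thesis
        using z \<rho>(1)[of z] \<rho>0[of z] by (simp add: g_def)
    next
      case False
      then have "T (h z) \<le> 0" "p z = - \<rho> z"
        using hnU[of z] z by (auto simp: T_def p_def)
      then show ?thesis
        using z \<rho>(1)[of z] \<rho>0[of z] by (simp add: g_def)
    qed
    then show "hausdorff_measure s {z \<in> K. g z = f x} = 0"
      by (intro hausdorff_null_subset[OF nullG]) auto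
  qed
qed

text \<open>Perturb \<open>f\<close> so that its level set through some \<open>x\<close> becomes
  null and gets an open small cover. For nearby \<open>h\<close>, the level set of \<open>h\<close>
  through the same \<open>x\<close> stays in that cover, though its value may move.\<close>

lemma nowhere_dense_no_small_level_set:
  fixes K :: "'a::metric_space set"
  assumes "compact K" "s > 0" "dim_tH K < ereal (s + 1)" "\<delta> > 0"
  shows "nowhere_dense_in (mtopology_of (C_space K))
    {f \<in> mspace (C_space K). (\<exists>x\<in>K. a < f x \<and> f x < b) \<and>
       \<not> (\<exists>x\<in>K. a < f x \<and> f x < b \<and> small_cover s \<delta> {z \<in> K. f z = f x})}"
    (is "nowhere_dense_in _ ?N")
proof (rule nowhere_dense_in_C_spaceI[OF assms(1)], blast)
  fix f e assume f: "f \<in> ?N" and e: "(e::real) > 0"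
  then obtain x where x: "x \<in> K" "a < f x" "f x < b"
    by blast
  have "continuous_on K f"
    using f by (simp add: mspace_C_space[OF assms(1)])
  from perturb_to_null_level_set[OF assms(1-3) this x(1) e] obtain g where
    g: "continuous_on K g" "g x = f x" "\<forall>z\<in>K. \<bar>g z - f z\<bar> \<le> e"
      "hausdorff_measure s {z \<in> K. g z = f x} = 0"
    by blast
  obtain W where W: "open W" "{z \<in> K. g z = f x} \<subseteq> W" "hausdorff_premeasure s \<delta> W < ennreal \<delta>"
    using hausdorff_null_open_superset[OF g(4) assms(2,4,4)] by blast
  obtain \<eta> where \<eta>: "\<eta> > 0" "\<And>z. \<lbrakk>z \<in> K; \<bar>g z - f x\<bar> < \<eta>\<rbrakk> \<Longrightarrow> z \<in> W"
    using level_set_neighbourhood[OF assms(1) g(1) W(1,2)] by blast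
  \<comment> \<open>If \<open>h z = h x\<close>, then \<open>g z\<close> is within
    \<open>2 * d < \<eta>\<close> of \<open>f x\<close>; the other two terms keep \<open>h x\<close>
    between \<open>a\<close> and \<open>b\<close>.\<close>
  define d where "d = min (\<eta> / 3) (min ((f x - a) / 2) ((b - f x) / 2))"
  have d: "d > 0" "d \<le> \<eta> / 3" "d \<le> (f x - a) / 2" "d \<le> (b - f x) / 2"
    unfolding d_def using \<eta>(1) x by (simp, linarith+)
  have "h \<notin> ?N" if h: "\<forall>z\<in>K. \<bar>h z - g z\<bar> \<le> d" for h
  proof -
    have hx: "\<bar>h x - f x\<bar> \<le> d"
      using h x(1) g(2) by metis
    have "{z \<in> K. h z = h x} \<subseteq> W"
    proof clarify
      fix z assume z: "z \<in> K" "h z = h x"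
      then have "\<bar>h x - g z\<bar> \<le> d"
        using h by metis
      then show "z \<in> W"
        using hx d \<eta>(1) by (intro \<eta>(2)[OF z(1)]) linarith
    qed
    then have "small_cover s \<delta> {z \<in> K. h z = h x}"
      using W unfolding small_cover_def by blast
    moreover have "a < h x" "h x < b"
      using hx d x by (auto simp: abs_le_iff)
    ultimately show ?thesis
      using x(1) by blast
  qed
  then show "\<exists>g d. d > 0 \<and> continuous_on K g \<and> (\<forall>x\<in>K. \<bar>g x - f x\<bar> \<le> e) \<and>
      (\<forall>h\<in>?N. \<not> (\<forall>x\<in>K. \<bar>h x - g x\<bar> \<le> d))"
    using g d(1) by blast
qed

section \<open>Generic level sets\<close>

text \<open>A small piece \<open>L\<close> around a preimage of \<open>y\<close> has its image in
  \<open>T\<close>. Since \<open>s \<ge> -1\<close>, the level sets over the interval from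
  \<open>a\<close> to \<open>b\<close> are non-empty, so this interval is a relatively open part of
  \<open>T\<close> without bad values.\<close>

lemma nowhere_dense_values_if_small_copies:
  fixes K :: "'a::metric_space set" and f :: "'a \<Rightarrow> real"
  assumes "continuous_on K f" "s \<ge> -1"
    and copies: "\<And>x e. \<lbrakk>x \<in> K; e > 0\<rbrakk> \<Longrightarrow> \<exists>L a b. L \<subseteq> K \<and> L \<subseteq> ball x e \<and> a < b \<and>
      (\<forall>c. a < c \<and> c < b \<longrightarrow> ereal s < dim_H {z \<in> L. f z = c})"
  shows "nowhere_dense_in (top_of_set (f ` K)) {y \<in> f ` K. dim_H {z \<in> K. f z = y} \<le> ereal s}"
    (is "nowhere_dense_in _ ?N")
proof (rule nowhere_dense_inI)
  fix T y assume T: "openin (top_of_set (f ` K)) T" "y \<in> T" "y \<in> ?N"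
  then obtain x where x: "x \<in> K" "y = f x"
    by blast
  have "openin (top_of_set K) (K \<inter> f -` T)"
    using continuous_openin_preimage[OF assms(1) _ T(1)] by blast
  then obtain e where e: "e > 0" "ball x e \<inter> K \<subseteq> K \<inter> f -` T"
    using T(2) x unfolding openin_contains_ball by blast
  obtain L a b where L: "L \<subseteq> K" "L \<subseteq> ball x e" "a < b"
      "\<And>c. \<lbrakk>a < c; c < b\<rbrakk> \<Longrightarrow> ereal s < dim_H {z \<in> L. f z = c}"
    using copies[OF x(1) e(1)] by blast
  have "f ` L \<subseteq> T"
    using L e by blast
  moreover have fL: "{a<..<b} \<subseteq> f ` L"
  proof
    fix c assume c: "c \<in> {a<..<b}"
    have "{z \<in> L. f z = c} \<noteq> {}"
    proof
      assume "{z \<in> L. f z = c} = {}"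
      then have "ereal s < -1"
        using L(4)[of c] c by (simp add: dim_H_def)
      then show False
        using assms(2) by (simp add: one_ereal_def)
    qed
    then show "c \<in> f ` L"
      by blast
  qed
  moreover have "{a<..<b} \<inter> ?N = {}"
  proof -
    have "c \<notin> ?N" if "c \<in> {a<..<b}" for c
    proof -
      have "ereal s < dim_H {z \<in> L. f z = c}"
        using L(4) that by simp
      also have "\<dots> \<le> dim_H {z \<in> K. f z = c}"
        using L(1) by (intro dim_H_mono) auto
      finally show ?thesis
        by (simp add: not_le)
    qed
    then show ?thesis
      by blast
  qed
  moreover have "openin (top_of_set (f ` K)) {a<..<b}"
    using fL L(1) by (intro open_subset) auto
  ultimately show "\<exists>T'. openin (top_of_set (f ` K)) T' \<and> T' \<noteq> {} \<and> T' \<subseteq> T \<and> T' \<inter> ?N = {}"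
    using L(3) by (intro exI[of _ "{a<..<b}"]) auto
qed auto

text \<open>Near any \<open>y\<close> some value has a small cover, and the same cover works for all
  values close to that one. Rational endpoints keep the number of conditions on \<open>f\<close>
  countable.\<close>

lemma nowhere_dense_values_not_small_cover:
  fixes K :: "'a::metric_space set" and f :: "'a \<Rightarrow> real"
  assumes "compact K" "continuous_on K f"
    and small: "\<And>a b. \<lbrakk>a \<in> \<rat>; b \<in> \<rat>; \<exists>x\<in>K. a < f x \<and> f x < b\<rbrakk> \<Longrightarrow>
      \<exists>x\<in>K. a < f x \<and> f x < b \<and> small_cover s \<delta> {z \<in> K. f z = f x}"
  shows "nowhere_dense_in (top_of_set (f ` K)) {y \<in> f ` K. \<not> small_cover s \<delta> {z \<in> K. f z = y}}"
    (is "nowhere_dense_in _ ?N")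
proof (rule nowhere_dense_inI)
  fix T y assume T: "openin (top_of_set (f ` K)) T" "y \<in> T" "y \<in> ?N"
  then obtain e where e: "e > 0" "ball y e \<inter> f ` K \<subseteq> T"
    by (metis openin_contains_ball)
  obtain a where a: "a \<in> \<rat>" "y - e < a" "a < y"
    using Rats_dense_in_real[of "y - e" y] e(1) by auto
  obtain b where b: "b \<in> \<rat>" "y < b" "b < y + e"
    using Rats_dense_in_real[of y "y + e"] e(1) by auto
  have "\<exists>x\<in>K. a < f x \<and> f x < b"
    using a b T(3) by auto
  then obtain x W where x: "x \<in> K" "a < f x" "f x < b"
    and W: "open W" "{z \<in> K. f z = f x} \<subseteq> W" "hausdorff_premeasure s \<delta> W < ennreal \<delta>"
    using small[OF a(1) b(1)] unfolding small_cover_def by blast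
  obtain \<eta> where \<eta>: "\<eta> > 0" "\<And>z. \<lbrakk>z \<in> K; \<bar>f z - f x\<bar> < \<eta>\<rbrakk> \<Longrightarrow> z \<in> W"
    using level_set_neighbourhood[OF assms(1,2) W(1,2)] by blast
  let ?T = "f ` K \<inter> ({a<..<b} \<inter> ball (f x) \<eta>)"
  have "c \<notin> ?N" if "c \<in> ?T" for c
  proof -
    have "{z \<in> K. f z = c} \<subseteq> W"
      using that \<eta>(2) by (auto simp: dist_real_def abs_minus_commute)
    then show ?thesis
      using W unfolding small_cover_def by blast
  qed
  moreover have "?T \<subseteq> T"
  proof
    fix c assume "c \<in> ?T"
    then have "c \<in> ball y e \<inter> f ` K"
      using a b by (auto simp: dist_real_def abs_if)
    then show "c \<in> T"
      using e(2) by blast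
  qed
  moreover have "f x \<in> ?T"
    using x \<eta>(1) by auto
  moreover have "openin (top_of_set (f ` K)) ?T"
    by (intro openin_open_Int open_Int) auto
  ultimately show "\<exists>T'. openin (top_of_set (f ` K)) T' \<and> T' \<noteq> {} \<and> T' \<subseteq> T \<and> T' \<inter> ?N = {}"
    by (intro exI[of _ ?T]) blast
qed auto

theorem corollary7p17:
  fixes K :: "'a::metric_space set"
  assumes "compact K"
    and "self_similar K"
    and "dim_t (top_of_set K) > 0"
  shows "generic_in (mtopology_of (C_space K))
           (\<lambda>f. generic_in (top_of_set (f ` K))
                  (\<lambda>y. dim_H {x \<in> K. f x = y} = dim_tH K - 1))"
proof -
  let ?D = "dim_tH K"
  \<comment> \<open>Positive topological dimension enters here; it makes every
    \<open>s > ?D - 1\<close> positive.\<close>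
  have D1: "1 \<le> ?D"
    by (rule dim_tH_ge_1[OF assms(3)])
  have ne: "K \<noteq> {}"
    using D1 by (auto simp: dim_tH_def one_ereal_def)
  define inv_n where "inv_n n = 1 / real (Suc n)" for n
  have inv_n: "inv_n n > 0" for n
    by (simp add: inv_n_def)
  have "\<forall>n. \<exists>\<Psi>. finite \<Psi> \<and> (\<forall>h\<in>\<Psi>. \<exists>r. similitude_on r K h) \<and> K \<subseteq> (\<Union>h\<in>\<Psi>. h ` K) \<and>
      (\<forall>h\<in>\<Psi>. \<forall>x\<in>h ` K. \<forall>y\<in>h ` K. dist x y < inv_n n)"
    using self_similar_small_copies[OF compact_imp_bounded[OF assms(1)] assms(2)] inv_n by blast
  then obtain \<Psi> where \<Psi>: "\<And>n. finite (\<Psi> n)" "\<And>n h. h \<in> \<Psi> n \<Longrightarrow> \<exists>r. similitude_on r K h"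
      "\<And>n. K \<subseteq> (\<Union>h\<in>\<Psi> n. h ` K)"
      "\<And>n h x y. \<lbrakk>h \<in> \<Psi> n; x \<in> h ` K; y \<in> h ` K\<rbrakk> \<Longrightarrow> dist x y < inv_n n"
    by metis
  let ?M = "mspace (C_space K)"
  define N1 where "N1 s h = {f \<in> ?M. \<forall>a b. a < b \<longrightarrow>
      (\<exists>c. a < c \<and> c < b \<and> dim_H {z \<in> h ` K. f z = c} \<le> ereal s)}" for s h
  define N2 where "N2 s n a b = {f \<in> ?M. (\<exists>x\<in>K. a < f x \<and> f x < b) \<and>
      \<not> (\<exists>x\<in>K. a < f x \<and> f x < b \<and> small_cover s (inv_n n) {z \<in> K. f z = f x})}" for s n a b
  \<comment> \<open>Rational exponents keep the families countable. If \<open>?D\<close> is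
    infinite, \<open>S2\<close> is empty and the upper bound is trivial.\<close>
  define S1 where "S1 = {s \<in> \<rat>. -1 \<le> s \<and> ereal (s + 1) < ?D}"
  define S2 where "S2 = {s \<in> \<rat>. 0 < s \<and> ?D < ereal (s + 1)}"
  have countable_S: "countable S1" "countable S2"
    unfolding S1_def S2_def by (rule countable_subset[OF _ countable_rat], blast)+
  let ?\<N> = "(\<lambda>(s, h). N1 s h) ` (S1 \<times> (\<Union>n. \<Psi> n)) \<union>
    (\<lambda>(s, n, a, b). N2 s n a b) ` (S2 \<times> UNIV \<times> \<rat> \<times> \<rat>)"
  show ?thesis
  proof (rule generic_inI[of ?\<N>])
    show "countable ?\<N>"
      using countable_S \<Psi>(1) by (auto intro!: countable_SIGMA countable_UN simp: countable_finite countable_rat)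
    have "nowhere_dense_in (mtopology_of (C_space K)) (N1 s h)" if "s \<in> S1" "h \<in> \<Psi> n" for s h n
      using \<Psi>(2) that nowhere_dense_small_level_sets[OF assms(1) ne] unfolding N1_def S1_def by blast
    moreover have "nowhere_dense_in (mtopology_of (C_space K)) (N2 s n a b)" if "s \<in> S2" for s n a b
      using that nowhere_dense_no_small_level_set[OF assms(1) _ _ inv_n] unfolding N2_def S2_def by blast
    ultimately show "nowhere_dense_in (mtopology_of (C_space K)) N" if "N \<in> ?\<N>" for N
      using that by auto
  next
    fix f assume "f \<in> topspace (mtopology_of (C_space K))" "f \<notin> \<Union>?\<N>"
    then have f: "f \<in> ?M" "\<And>s h n. \<lbrakk>s \<in> S1; h \<in> \<Psi> n\<rbrakk> \<Longrightarrow> f \<notin> N1 s h"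
        "\<And>s n a b. \<lbrakk>s \<in> S2; a \<in> \<rat>; b \<in> \<rat>\<rbrakk> \<Longrightarrow> f \<notin> N2 s n a b"
      by fastforce+
    have fc: "continuous_on K f"
      using f(1) by (simp add: mspace_C_space[OF assms(1)])
    let ?lev = "\<lambda>y. {x \<in> K. f x = y}"
    \<comment> \<open>For the fixed generic \<open>f\<close>, these are the exceptional values for
      the lower and the upper bound.\<close>
    define Y1 where "Y1 s = {y \<in> f ` K. dim_H (?lev y) \<le> ereal s}" for s
    define Y2 where "Y2 s n = {y \<in> f ` K. \<not> small_cover s (inv_n n) (?lev y)}" for s n
    have Y1: "nowhere_dense_in (top_of_set (f ` K)) (Y1 s)" if "s \<in> S1" for s
      unfolding Y1_def
    proof (rule nowhere_dense_values_if_small_copies[OF fc])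
      show "-1 \<le> s"
        using that by (simp add: S1_def)
      fix x e assume x: "x \<in> K" and "(e::real) > 0"
      then obtain n where n: "inv_n n < e"
        unfolding inv_n_def using nat_approx_posE by blast
      obtain h where h: "h \<in> \<Psi> n" "x \<in> h ` K"
        using \<Psi>(3)[of n] x by blast
      have "h ` K \<subseteq> ball x e"
        using \<Psi>(4)[OF h] n by force
      moreover have "h ` K \<subseteq> K"
        using \<Psi>(2)[OF h(1)] by (auto simp: similitude_on_def)
      moreover have "\<exists>a b. a < b \<and> (\<forall>c. a < c \<and> c < b \<longrightarrow> \<not> dim_H {z \<in> h ` K. f z = c} \<le> ereal s)"
        using f(1) f(2)[OF \<open>s \<in> S1\<close> h(1)] unfolding N1_def by blast
      ultimately show "\<exists>L a b. L \<subseteq> K \<and> L \<subseteq> ball x e \<and> a < b \<and>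
          (\<forall>c. a < c \<and> c < b \<longrightarrow> ereal s < dim_H {z \<in> L. f z = c})"
        unfolding not_le by blast
    qed
    have Y2: "nowhere_dense_in (top_of_set (f ` K)) (Y2 s n)" if "s \<in> S2" for s n
      unfolding Y2_def
    proof (rule nowhere_dense_values_not_small_cover[OF assms(1) fc])
      fix a b assume "a \<in> \<rat>" "b \<in> \<rat>" "\<exists>x\<in>K. a < f x \<and> f x < b"
      then show "\<exists>x\<in>K. a < f x \<and> f x < b \<and> small_cover s (inv_n n) {z \<in> K. f z = f x}"
        using f(1) f(3)[OF that, of a b n] unfolding N2_def by blast
    qed
    let ?\<Y> = "Y1 ` S1 \<union> (\<lambda>(s, n). Y2 s n) ` (S2 \<times> UNIV)"
    show "generic_in (top_of_set (f ` K)) (\<lambda>y. dim_H (?lev y) = ?D - 1)"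
    proof (rule generic_inI[of ?\<Y>])
      show "countable ?\<Y>"
        using countable_S by auto
      show "nowhere_dense_in (top_of_set (f ` K)) N" if "N \<in> ?\<Y>" for N
        using that Y1 Y2 by auto
    next
      fix y assume "y \<in> topspace (top_of_set (f ` K))" "y \<notin> \<Union>?\<Y>"
      then have y: "y \<in> f ` K" "\<And>s. s \<in> S1 \<Longrightarrow> y \<notin> Y1 s" "\<And>s n. s \<in> S2 \<Longrightarrow> y \<notin> Y2 s n"
        by auto
      have lev: "?lev y \<noteq> {}"
        using y(1) by auto
      show "dim_H (?lev y) = ?D - 1"
      proof (rule antisym; rule ccontr)
        assume "\<not> dim_H (?lev y) \<le> ?D - 1"
        \<comment> \<open>A rational strictly between the two sides lies in \<open>S2\<close>; the
          small covers for all \<open>n\<close> make the level set \<open>s\<close>-null, against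
          its dimension exceeding \<open>s\<close>.\<close>
        then obtain s where s: "s \<in> \<rat>" "?D - 1 < ereal s" "ereal s < dim_H (?lev y)"
          using ereal_dense3[of "?D - 1" "dim_H (?lev y)"] that Rats_of_rat unfolding not_le by blast
        have "s \<in> S2"
          using s(1,2) D1 by (cases ?D) (auto simp: S2_def one_ereal_def)
        then have "small_cover s (inv_n n) (?lev y)" for n
          using y(1) y(3)[of s n] by (simp add: Y2_def)
        then have "hausdorff_measure s (?lev y) = 0"
          unfolding inv_n_def by (rule hausdorff_null_if_small_cover)
        then have "dim_H (?lev y) \<le> ereal s"
          using lev \<open>s \<in> S2\<close> by (auto simp: dim_H_def S2_def intro!: Inf_lower)
        then show False
          using s(3) by simp
      next
        assume "\<not> ?D - 1 \<le> dim_H (?lev y)"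
        then obtain s where s: "s \<in> \<rat>" "dim_H (?lev y) < ereal s" "ereal s < ?D - 1"
          using ereal_dense3[of "dim_H (?lev y)" "?D - 1"] that Rats_of_rat unfolding not_le by blast
        \<comment> \<open>The level set is non-empty, so its dimension is non-negative; this yields
          the lower bound on \<open>s\<close> required in \<open>S1\<close>.\<close>
        have "ereal 0 < ereal s"
          using dim_H_nonneg[OF lev] s(2) by (metis le_less_trans zero_ereal_def)
        then have "s \<in> S1"
          using s(1,3) by (cases ?D) (auto simp: S1_def one_ereal_def)
        then show False
          using y(1) y(2)[of s] s(2) by (simp add: Y1_def)
      qed
    qed
  qed
qed

end
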